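(* For a two-dimensional complex pre-Lie algebra $A$, let $O(A)\subseteq \mathcal{P}_2(\mathbb{C})$ denote the $GL_2(\mathbb{C})$-orbit of the structures representing $A$, and let $\overline{O(A)}$ denote its Zariski closure. With the algebras $A_1,\dots,A_5$, $B_1(\alpha)$, $B_2(\beta)$, $B_3,B_4,B_5$ defined in the context, the set $\overline{O(A)}\setminus O(A)$ is the union of the orbits of exactly the following algebras (that is, $A$ properly degenerates to exactly these algebras, up to isomorphism): \begin{itemize} \item $A=A_3$: $A_2, A_4, A_5, A_1$; \item $A=B_4$: $B_1(-2), B_2(-1), A_5, A_1$; \item $A=A_2$: $A_5, A_1$; \item $A=A_4$: $A_5, A_1$; \item $A=B_1(\alpha)$, for every $\alpha\in\mathbb{C}$ with $\alpha\neq -1$: $A_5, A_1$; \item $A=B_2(\beta)$, for every $\beta\in\mathbb{C}$ with $\beta\neq 0,1$: $A_5, A_1$; \item $A=B_3$: $A_5, B_1(-1), A_1$; \item $A=B_5$: $A_5, B_2(1), A_1$; \item $A=A_5$: $A_1$; \item $A=B_1(-1)$: $A_1$; \item $A=B_2(1)$: $A_1$. \end{itemize}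
   Context: A pre-Lie algebra over a field $K$ is a $K$-vector space with a bilinear product satisfying $(x\cdot y)\cdot z-x\cdot(y\cdot z)=(y\cdot x)\cdot z-y\cdot(x\cdot z)$ for all $x,y,z$. Fix an $n$-dimensional $K$-vector space $V$ with basis $(e_1,\dots,e_n)$. $\mathcal{P}_n(K)\subseteq K^{n^3}$ is the affine algebraic set of all structure constants $(c_{ij}^k)$ of pre-Lie algebra products $e_i\cdot e_j=\sum_k c_{ij}^k e_k$ on $V$; it is called the variety of pre-Lie algebra structures. $GL_n(K)$ acts on it by $(g\circ\mu)(x,y)=g(\mu(g^{-1}x,g^{-1}y))$; orbits correspond to isomorphism classes. $O(\mu)$ is the orbit of $\mu$ and $\overline{O(\mu)}$ its Zariski closure. One says $\lambda$ degenerates to $\mu$ if $\mu\in\overline{O(\lambda)}$, and properly if moreover $\mu\notin O(\lambda)$. An algebra $A$ degenerates to $B$ if a structure representing $A$ degenerates to one representing $B$. Two-dimensional complex pre-Lie algebras, in a basis $(e_1,e_2)$ (products not listed are zero): $A_1$: all products zero; $A_2$: $e_1\cdot e_1=e_1$; $A_3$: $e_1\cdot e_1=e_1$, $e_2\cdot e_2=e_2$; $A_4$: $e_1\cdot e_2=e_1$, $e_2\cdot e_1=e_1$, $e_2\cdot e_2=e_2$; $A_5$: $e_2\cdot e_2=e_1$; $B_1(\alpha)$, $\alpha\in\mathbb{C}$: $e_2\cdot e_1=-e_1$, $e_2\cdot e_2=\alpha e_2$; $B_2(\beta)$, $\beta\in\mathbb{C}$, $\beta\neq 0$: $e_1\cdot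 e_2=\beta e_1$, $e_2\cdot e_1=(\beta-1)e_1$, $e_2\cdot e_2=\beta e_2$; $B_3$: $e_2\cdot e_1=-e_1$, $e_2\cdot e_2=e_1-e_2$; $B_4$: $e_1\cdot e_1=e_2$, $e_2\cdot e_1=-e_1$, $e_2\cdot e_2=-2e_2$; $B_5$: $e_1\cdot e_2=e_1$, $e_2\cdot e_2=e_1+e_2$. By a known classification, every two-dimensional complex pre-Lie algebra is isomorphic to one in this list. *)

theory Defs
  imports "HOL-Analysis.Analysis"
begin

section \<open>Structure constants and pre-Lie algebra structures\<close>

text \<open>
  A point \<open>c\<close> of $K^{n^3}$ is a family of structure constants on $V = K^n$ with its standard
  basis \<open>e\<^sub>i = axis i 1\<close>; the entry \<open>c $ i $ j $ k\<close> is $c_{ij}^k$, so \<open>c $ i $ j\<close> is the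
  coordinate vector of the product of \<open>e\<^sub>i\<close> and \<open>e\<^sub>j\<close>.
\<close>

type_synonym ('k, 'n) structure_constants = "'k ^ 'n ^ 'n ^ 'n"

definition alg_mult ::
    "('k::field, 'n::finite) structure_constants \<Rightarrow> 'k ^ 'n \<Rightarrow> 'k ^ 'n \<Rightarrow> 'k ^ 'n" where
  "alg_mult c x y = (\<Sum>i\<in>UNIV. \<Sum>j\<in>UNIV. (x $ i * y $ j) *s (c $ i $ j))"

definition structure_constants_of ::
    "('k ^ 'n \<Rightarrow> 'k ^ 'n \<Rightarrow> 'k ^ 'n) \<Rightarrow> ('k::field, 'n::finite) structure_constants" where
  "structure_constants_of \<mu> = (\<chi> i j. \<mu> (axis i 1) (axis j 1))"

definition pre_Lie_variety :: "('k::field, 'n::finite) structure_constants set" where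
  "pre_Lie_variety = {c. \<forall>x y z.
     alg_mult c (alg_mult c x y) z - alg_mult c x (alg_mult c y z) =
     alg_mult c (alg_mult c y x) z - alg_mult c y (alg_mult c x z)}"

definition GL_act ::
    "'k ^ 'n ^ 'n \<Rightarrow> ('k::field, 'n::finite) structure_constants \<Rightarrow> ('k, 'n) structure_constants" where
  "GL_act g c =
     structure_constants_of (\<lambda>x y. g *v alg_mult c (matrix_inv g *v x) (matrix_inv g *v y))"

definition GL_orbit ::
    "('k::field, 'n::finite) structure_constants \<Rightarrow> ('k, 'n) structure_constants set" where
  "GL_orbit c = {GL_act g c | g. invertible g}"

section \<open>The Zariski topology on the space of structure constants\<close>

inductive polynomial_fun :: "(('k::field, 'n::finite) structure_constants \<Rightarrow> 'k) \<Rightarrow> bool" where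
  const: "polynomial_fun (\<lambda>c. a)"
| coord: "polynomial_fun (\<lambda>c. c $ i $ j $ k)"
| add: "polynomial_fun p \<Longrightarrow> polynomial_fun q \<Longrightarrow> polynomial_fun (\<lambda>c. p c + q c)"
| mult: "polynomial_fun p \<Longrightarrow> polynomial_fun q \<Longrightarrow> polynomial_fun (\<lambda>c. p c * q c)"

definition Zariski_closed :: "('k::field, 'n::finite) structure_constants set \<Rightarrow> bool" where
  "Zariski_closed S \<longleftrightarrow> (\<exists>F. (\<forall>p\<in>F. polynomial_fun p) \<and> S = {c. \<forall>p\<in>F. p c = 0})"

text \<open>
  The closure is formed in the ambient affine space. As \<open>pre_Lie_variety\<close> is Zariski closed
  and stable under \<open>GL_act\<close> (both shown below), this agrees with the closure in the variety.
\<close>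

definition Zariski_closure ::
    "('k::field, 'n::finite) structure_constants set \<Rightarrow> ('k, 'n) structure_constants set" where
  "Zariski_closure S = Zariski_closed hull S"

section \<open>Two-dimensional complex pre-Lie algebras\<close>

abbreviation e\<^sub>1 :: "complex ^ 2" where "e\<^sub>1 \<equiv> axis 1 1"
abbreviation e\<^sub>2 :: "complex ^ 2" where "e\<^sub>2 \<equiv> axis 2 1"

text \<open>\<open>alg2 u v w z\<close>: here \<open>e\<^sub>1\<cdot>e\<^sub>1 = u\<close>, \<open>e\<^sub>1\<cdot>e\<^sub>2 = v\<close>, \<open>e\<^sub>2\<cdot>e\<^sub>1 = w\<close>, \<open>e\<^sub>2\<cdot>e\<^sub>2 = z\<close>.\<close>

definition alg2 :: "complex ^ 2 \<Rightarrow> complex ^ 2 \<Rightarrow> complex ^ 2 \<Rightarrow> complex ^ 2 \<Rightarrow>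
    (complex, 2) structure_constants" where
  "alg2 u v w z = vector [vector [u, v], vector [w, z]]"

definition "A\<^sub>1 = alg2 0 0 0 0"
definition "A\<^sub>2 = alg2 e\<^sub>1 0 0 0"
definition "A\<^sub>3 = alg2 e\<^sub>1 0 0 e\<^sub>2"
definition "A\<^sub>4 = alg2 0 e\<^sub>1 e\<^sub>1 e\<^sub>2"
definition "A\<^sub>5 = alg2 0 0 0 e\<^sub>1"
definition "B\<^sub>1 \<alpha> = alg2 0 0 (- e\<^sub>1) (\<alpha> *s e\<^sub>2)"
text \<open>The family \<open>B\<^sub>2 \<beta>\<close> is only considered for \<open>\<beta> \<noteq> 0\<close>.\<close>
definition "B\<^sub>2 \<beta> = alg2 0 (\<beta> *s e\<^sub>1) ((\<beta> - 1) *s e\<^sub>1) (\<beta> *s e\<^sub>2)"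
definition "B\<^sub>3 = alg2 0 0 (- e\<^sub>1) (e\<^sub>1 - e\<^sub>2)"
definition "B\<^sub>4 = alg2 e\<^sub>2 0 (- e\<^sub>1) ((-2) *s e\<^sub>2)"
definition "B\<^sub>5 = alg2 0 e\<^sub>1 0 (e\<^sub>1 + e\<^sub>2)"

section \<open>Consistency of the definitions\<close>

lemma alg_mult_add_left: "alg_mult c (x + y) z = alg_mult c x z + alg_mult c y z"
  by (simp add: alg_mult_def vec_eq_iff sum.distrib algebra_simps)

lemma alg_mult_add_right: "alg_mult c x (y + z) = alg_mult c x y + alg_mult c x z"
  by (simp add: alg_mult_def vec_eq_iff sum.distrib algebra_simps)

lemma alg_mult_scale_left: "alg_mult c (a *s x) z = a *s alg_mult c x z"
  by (simp add: alg_mult_def vec_eq_iff sum_distrib_left algebra_simps)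

lemma alg_mult_scale_right: "alg_mult c x (a *s z) = a *s alg_mult c x z"
  by (simp add: alg_mult_def vec_eq_iff sum_distrib_left algebra_simps)

lemma alg_mult_sum_left: "alg_mult c (\<Sum>i\<in>S. f i) z = (\<Sum>i\<in>S. alg_mult c (f i) z)"
proof (induction S rule: infinite_finite_induct)
  case (insert x F) then show ?case by (simp add: alg_mult_add_left)
qed (simp_all add: alg_mult_def vec_eq_iff)

lemma alg_mult_sum_right: "alg_mult c z (\<Sum>i\<in>S. f i) = (\<Sum>i\<in>S. alg_mult c z (f i))"
proof (induction S rule: infinite_finite_induct)
  case (insert x F) then show ?case by (simp add: alg_mult_add_right)
qed (simp_all add: alg_mult_def vec_eq_iff)

lemma alg_mult_axis: "alg_mult c (axis i 1) (axis j 1) = c $ i $ j"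
proof -
  have "(\<Sum>b\<in>UNIV. (axis i 1 $ a * axis j 1 $ b) *s (c $ a $ b)) =
      (if a = i then c $ i $ j else 0)" for a
    by (auto simp: axis_def vec_eq_iff if_distrib[of "\<lambda>x. x * _"] cong: if_cong)
  then show ?thesis by (simp add: alg_mult_def)
qed

lemma alg_mult_GL_act:
  "alg_mult (GL_act g c) x y = g *v alg_mult c (matrix_inv g *v x) (matrix_inv g *v y)"
proof -
  define h where "h = matrix_inv g"
  define m where "m = (\<lambda>x y. g *v alg_mult c (h *v x) (h *v y))"
  have ex: "x = (\<Sum>i\<in>UNIV. x $ i *s axis i 1)" for x :: "'a ^ 'b"
    by (simp add: basis_expansion)
  have sl: "m (\<Sum>i\<in>UNIV. x $ i *s axis i 1) y = (\<Sum>i\<in>UNIV. x $ i *s m (axis i 1) y)" for x y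
    by (simp add: m_def alg_mult_sum_left alg_mult_scale_left
        vec.scale vec.sum)
  have sr: "m x (\<Sum>i\<in>UNIV. y $ i *s axis i 1) = (\<Sum>i\<in>UNIV. y $ i *s m x (axis i 1))" for x y
    by (simp add: m_def alg_mult_sum_right alg_mult_scale_right vec.scale vec.sum)
  have "m x y = (\<Sum>i\<in>UNIV. x $ i *s (\<Sum>j\<in>UNIV. y $ j *s m (axis i 1) (axis j 1)))"
    by (metis (no_types, lifting) ex sl sr sum.cong)
  also have "\<dots> = alg_mult (GL_act g c) x y"
    by (simp add: alg_mult_def GL_act_def structure_constants_of_def m_def h_def vec_eq_iff
        sum_distrib_left mult.assoc)
  finally show ?thesis by (simp add: m_def h_def)
qed

lemma GL_orbit_subset_pre_Lie_variety:
  assumes "c \<in> pre_Lie_variety"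
  shows "GL_orbit c \<subseteq> pre_Lie_variety"
proof
  fix d assume "d \<in> GL_orbit c"
  then obtain g where g: "invertible g" and d: "d = GL_act g c" by (auto simp: GL_orbit_def)
  have [simp]: "matrix_inv g *v (g *v x) = x" for x
    using someI_ex[OF g[unfolded invertible_def]]
    by (simp add: matrix_vector_mul_assoc matrix_inv_def)
  show "d \<in> pre_Lie_variety"
    using assms by (simp add: d pre_Lie_variety_def alg_mult_GL_act flip: vec.diff)
qed

lemma polynomial_fun_sum: "(\<And>i. i \<in> S \<Longrightarrow> polynomial_fun (f i)) \<Longrightarrow> polynomial_fun (\<lambda>c. \<Sum>i\<in>S. f i c)"
proof (induction S rule: infinite_finite_induct)
  case (insert x F) then show ?case by (simp add: polynomial_fun.add)
qed (simp_all add: polynomial_fun.const)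

lemma polynomial_fun_diff: "polynomial_fun p \<Longrightarrow> polynomial_fun q \<Longrightarrow> polynomial_fun (\<lambda>c. p c - q c)"
  using polynomial_fun.add[of p "\<lambda>c. - 1 * q c"] polynomial_fun.mult[OF polynomial_fun.const, of q "-1"]
  by simp

lemma polynomial_fun_alg_mult:
  assumes "\<And>i. polynomial_fun (\<lambda>c. f c $ i)" "\<And>i. polynomial_fun (\<lambda>c. h c $ i)"
  shows "polynomial_fun (\<lambda>c. alg_mult c (f c) (h c) $ k)"
  unfolding alg_mult_def using assms
  by (simp, intro polynomial_fun_sum polynomial_fun.intros)

lemma Zariski_closed_pre_Lie_variety: "Zariski_closed pre_Lie_variety"
proof -
  define D where "D = (\<lambda>x y z (c::('a, 'b) structure_constants).
     (alg_mult c (alg_mult c x y) z - alg_mult c x (alg_mult c y z)) -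
     (alg_mult c (alg_mult c y x) z - alg_mult c y (alg_mult c x z)))"
  define F where "F = {\<lambda>c. D x y z c $ k | x y z k. True}"
  have "\<forall>p\<in>F. polynomial_fun p"
    unfolding F_def D_def
    by (auto intro!: polynomial_fun_diff polynomial_fun_alg_mult polynomial_fun.const)
  moreover have "pre_Lie_variety = {c. \<forall>p\<in>F. p c = 0}"
    unfolding F_def D_def pre_Lie_variety_def by (fastforce simp: vec_eq_iff)
  ultimately show ?thesis unfolding Zariski_closed_def by blast
qed

lemma Zariski_closure_GL_orbit_subset:
  "c \<in> pre_Lie_variety \<Longrightarrow> Zariski_closure (GL_orbit c) \<subseteq> pre_Lie_variety"
  unfolding Zariski_closure_def
  by (rule hull_minimal) (simp_all add: GL_orbit_subset_pre_Lie_variety Zariski_closed_pre_Lie_variety)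

lemma pre_Lie_algebras:
  "A\<^sub>1 \<in> pre_Lie_variety" "A\<^sub>2 \<in> pre_Lie_variety" "A\<^sub>3 \<in> pre_Lie_variety" "A\<^sub>4 \<in> pre_Lie_variety"
  "A\<^sub>5 \<in> pre_Lie_variety" "B\<^sub>1 \<alpha> \<in> pre_Lie_variety" "B\<^sub>2 \<beta> \<in> pre_Lie_variety"
  "B\<^sub>3 \<in> pre_Lie_variety" "B\<^sub>4 \<in> pre_Lie_variety" "B\<^sub>5 \<in> pre_Lie_variety"
  by (simp_all add: pre_Lie_variety_def A\<^sub>1_def A\<^sub>2_def A\<^sub>3_def A\<^sub>4_def A\<^sub>5_def B\<^sub>1_def B\<^sub>2_def B\<^sub>3_def
      B\<^sub>4_def B\<^sub>5_def alg2_def alg_mult_def vec_eq_iff sum_2 forall_2 axis_def algebra_simps)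

end

theory Submission
  imports Defs
begin

text \<open>
  Two independent mechanisms determine the closures.

  Degenerations come from contracting a basis. If \<open>f t\<close>, \<open>h t\<close> is a basis of the plane for every
  \<open>t \<noteq> 0\<close>, its multiplication table lies in the orbit, and a limit of these tables for \<open>t \<rightarrow> 0\<close>
  lies in the Euclidean closure of the orbit. Polynomials are continuous, so the Euclidean closure
  is contained in the Zariski closure. Scaling both basis vectors by \<open>t\<close> reaches \<open>A\<^sub>1\<close> from every
  algebra; the basis \<open>t\<^sup>2 x\<^sup>2, t x\<close> reaches \<open>A\<^sub>5\<close> as soon as some \<open>x\<close> is independent of its square,
  which fails only for \<open>A\<^sub>1\<close>, \<open>B\<^sub>1 (-1)\<close> and \<open>B\<^sub>2 1\<close>. Six further degenerations
  have bases of their own.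

  Non-degenerations come from polynomial conditions on structure constants that are invariant under
  change of basis: such a condition passes from an orbit to its Zariski closure. Write \<open>L x\<close> and
  \<open>R x\<close> for left and right multiplication by \<open>x\<close>. The main condition is
  \<open>tr (R x) = k (tr (R x) - tr (L x))\<close> for all \<open>x\<close>. Every noncommutative algebra satisfies it for
  exactly one \<open>k\<close>: the value is \<open>\<alpha>\<close> for \<open>B\<^sub>1 \<alpha>\<close>, \<open>2 \<beta>\<close> for \<open>B\<^sub>2 \<beta>\<close>, and \<open>-1, -2, 2\<close> for
  \<open>B\<^sub>3, B\<^sub>4, B\<^sub>5\<close>. Among the commutative algebras only \<open>A\<^sub>1\<close> and \<open>A\<^sub>5\<close> satisfy it, and they do
  for every \<open>k\<close>. Together with the classification of the two-dimensional pre-Lie algebras this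
  leaves for each closure only a handful of candidates (\<open>trace_relation_closure_cases\<close>,
  \<open>commutative_closure_cases\<close>). The wrong ones are removed by conditions such as "\<open>R x\<close> has
  a double eigenvalue" or "\<open>L x\<close> is scalar", and the same conditions show that the remaining
  candidates lie outside the orbit itself.

  The classification reduces to two normal forms. If the algebra is not commutative, the commutator
  of the plane has a one-dimensional image, and a basis with \<open>[e\<^sub>1, e\<^sub>2] = e\<^sub>1\<close> exists; the pre-Lie
  identity says that \<open>L\<close> is a representation of this Lie algebra, so \<open>L e\<^sub>1\<close> is nilpotent. If the
  algebra is commutative, it is associative, and either the square of every \<open>x\<close> is a multiple of \<open>x\<close> or
  some \<open>x\<close> generates it as the non-unital algebra of polynomials without constant term modulo a cubic.
\<close>

section \<open>Orbits and changes of basis\<close>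

lemma matrix_inv_mult:
  assumes "invertible g"
  shows "g ** matrix_inv g = mat 1" and "matrix_inv g ** g = mat 1"
  using someI_ex[OF assms[unfolded invertible_def]] by (simp_all add: matrix_inv_def)

lemma invertible_matrix_inv:
  assumes "invertible g"
  shows "invertible (matrix_inv g)"
  using matrix_inv_mult[OF assms] by (auto simp: invertible_def)

lemma matrix_inv_unique:
  assumes "g ** h = mat 1" "h ** g = mat 1"
  shows "matrix_inv g = h"
proof -
  have "invertible g" using assms by (auto simp: invertible_def)
  then have "matrix_inv g = matrix_inv g ** (g ** h)"
    by (simp add: assms)
  also have "\<dots> = h"
    by (simp add: matrix_mul_assoc matrix_inv_mult \<open>invertible g\<close>)
  finally show ?thesis .
qed

lemma structure_constants_eqI:
  assumes "\<And>x y. alg_mult c x y = alg_mult d x y"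
  shows "c = d"
  using assms[of "axis _ 1" "axis _ 1"] by (simp add: vec_eq_iff alg_mult_axis)

lemma GL_act_GL_act:
  assumes "invertible g" "invertible h"
  shows "GL_act g (GL_act h c) = GL_act (g ** h) c"
proof -
  have "matrix_inv (g ** h) = matrix_inv h ** matrix_inv g"
  proof (rule matrix_inv_unique)
    have "(g ** h) ** (matrix_inv h ** matrix_inv g) = g ** (h ** matrix_inv h) ** matrix_inv g"
      by (simp add: matrix_mul_assoc)
    then show "(g ** h) ** (matrix_inv h ** matrix_inv g) = mat 1"
      by (simp add: matrix_inv_mult assms)
    have "(matrix_inv h ** matrix_inv g) ** (g ** h) = matrix_inv h ** (matrix_inv g ** g) ** h"
      by (simp add: matrix_mul_assoc)
    then show "(matrix_inv h ** matrix_inv g) ** (g ** h) = mat 1"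
      by (simp add: matrix_inv_mult assms)
  qed
  then show ?thesis
    by (intro structure_constants_eqI) (simp add: alg_mult_GL_act matrix_vector_mul_assoc)
qed

lemma GL_act_mat_1: "GL_act (mat 1) c = c"
proof -
  have "matrix_inv (mat 1) = (mat 1 :: 'a ^ 'b ^ 'b)"
    by (rule matrix_inv_unique) simp_all
  then show ?thesis
    by (intro structure_constants_eqI) (simp add: alg_mult_GL_act)
qed

lemma GL_orbit_refl: "c \<in> GL_orbit c"
proof -
  have "invertible (mat 1)" unfolding invertible_def by (intro exI[of _ "mat 1"]) simp
  then show ?thesis using GL_act_mat_1[of c, symmetric] unfolding GL_orbit_def by blast
qed

lemma GL_orbit_sym:
  assumes "d \<in> GL_orbit c"
  shows "c \<in> GL_orbit d"
proof -
  obtain g where g: "invertible g" "d = GL_act g c"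
    using assms by (auto simp: GL_orbit_def)
  then have "c = GL_act (matrix_inv g) d"
    by (simp add: GL_act_GL_act invertible_matrix_inv matrix_inv_mult GL_act_mat_1)
  then show ?thesis
    using invertible_matrix_inv[OF g(1)] by (auto simp: GL_orbit_def)
qed

lemma GL_orbit_trans:
  assumes "d \<in> GL_orbit c" "e \<in> GL_orbit d"
  shows "e \<in> GL_orbit c"
  using assms by (auto simp: GL_orbit_def GL_act_GL_act intro: invertible_mult)

lemma alg2_nth [simp]:
  "alg2 u v w z $ 1 $ 1 = u" "alg2 u v w z $ 1 $ 2 = v"
  "alg2 u v w z $ 2 $ 1 = w" "alg2 u v w z $ 2 $ 2 = z"
  by (simp_all add: alg2_def)

lemma alg_mult_2:
  "alg_mult (c :: ('k::field, 2) structure_constants) x y =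
     (x $ 1 * y $ 1) *s (c $ 1 $ 1) + (x $ 1 * y $ 2) *s (c $ 1 $ 2) +
     (x $ 2 * y $ 1) *s (c $ 2 $ 1) + (x $ 2 * y $ 2) *s (c $ 2 $ 2)"
  by (simp add: alg_mult_def sum_2 algebra_simps)

lemma axis_2 [simp]:
  "axis 1 (a::'a::zero) $ (1::2) = a" "axis 1 a $ (2::2) = 0"
  "axis 2 a $ (1::2) = 0" "axis 2 a $ (2::2) = a"
  by (simp_all add: axis_def)

text \<open>
  Reading off the multiplication table of \<open>c\<close> in any basis \<open>(f, h)\<close> of the plane gives a point of
  the orbit of \<open>c\<close>: the matrix that acts is the inverse of the one with columns \<open>f\<close> and \<open>h\<close>.
\<close>
lemma table_in_basis_mem_GL_orbit:
  assumes indep: "f $ 1 * h $ 2 \<noteq> f $ 2 * h $ 1"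
    and "alg_mult c f f = u $ 1 *s f + u $ 2 *s h" "alg_mult c f h = v $ 1 *s f + v $ 2 *s h"
    and "alg_mult c h f = w $ 1 *s f + w $ 2 *s h" "alg_mult c h h = z $ 1 *s f + z $ 2 *s h"
  shows "alg2 u v w z \<in> GL_orbit c"
proof -
  define G :: "complex ^ 2 ^ 2" where "G = vector [vector [f $ 1, h $ 1], vector [f $ 2, h $ 2]]"
  have "det G \<noteq> 0" using indep by (simp add: G_def det_2 algebra_simps)
  then have G: "invertible G" by (simp add: invertible_det_nz)
  have Gv: "G *v x = x $ 1 *s f + x $ 2 *s h" for x
    by (simp add: vec_eq_iff forall_2 G_def matrix_vector_mult_def sum_2 algebra_simps)
  have GG: "matrix_inv G *v (G *v x) = x" for x
    using matrix_inv_mult(2)[OF G] by (simp add: matrix_vector_mul_assoc)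
  have "c = GL_act G (alg2 u v w z)"
  proof (rule structure_constants_eqI)
    fix x y
    define x' y' where "x' = matrix_inv G *v x" and "y' = matrix_inv G *v y"
    have x: "x = G *v x'" and y: "y = G *v y'"
      by (simp_all add: x'_def y'_def matrix_vector_mul_assoc matrix_inv_mult G)
    have "alg_mult c x y = G *v alg_mult (alg2 u v w z) x' y'"
      unfolding x y Gv
      by (simp add: alg_mult_add_left alg_mult_add_right alg_mult_scale_left
          alg_mult_scale_right assms) (simp add: alg_mult_2 vec_eq_iff algebra_simps)
    then show "alg_mult c x y = alg_mult (GL_act G (alg2 u v w z)) x y"
      by (simp add: alg_mult_GL_act x'_def y'_def)
  qed
  then have "c \<in> GL_orbit (alg2 u v w z)" using G by (auto simp: GL_orbit_def)
  then show ?thesis by (rule GL_orbit_sym)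
qed

section \<open>Degenerations by contracting a basis\<close>

lemma polynomial_fun_continuous:
  fixes p :: "(complex, 'n::finite) structure_constants \<Rightarrow> complex"
  assumes "polynomial_fun p"
  shows "continuous_on UNIV p"
  using assms by induction (auto intro!: continuous_intros)

lemma Zariski_closed_imp_closed:
  fixes S :: "(complex, 'n::finite) structure_constants set"
  assumes "Zariski_closed S"
  shows "closed S"
proof -
  obtain F where F: "\<And>p. p \<in> F \<Longrightarrow> polynomial_fun p" and "S = {c. \<forall>p\<in>F. p c = 0}"
    using assms unfolding Zariski_closed_def by blast
  then have S: "S = (\<Inter>p\<in>F. {c. p c = 0})" by auto
  have "closed {c. p c = 0}" if "p \<in> F" for p
    using polynomial_fun_continuous[OF F[OF that]] continuous_on_const by (rule closed_Collect_eq)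
  then show ?thesis unfolding S by (intro closed_INT ballI)
qed

lemma Zariski_closed_Inter:
  assumes "\<And>S. S \<in> \<A> \<Longrightarrow> Zariski_closed S"
  shows "Zariski_closed (\<Inter>\<A>)"
proof -
  define F where "F = {p. polynomial_fun p \<and> (\<exists>S\<in>\<A>. \<forall>c\<in>S. p c = 0)}"
  have "c \<in> S" if c: "\<forall>p\<in>F. p c = 0" and S: "S \<in> \<A>" for c S
  proof -
    obtain G where G: "\<forall>p\<in>G. polynomial_fun p" "S = {c. \<forall>p\<in>G. p c = 0}"
      using assms[OF S] unfolding Zariski_closed_def by (elim exE conjE)
    have "\<forall>d\<in>S. p d = 0" if "p \<in> G" for p using G(2) that by simp
    then have "G \<subseteq> F" using S G(1) by (auto simp: F_def)
    then show ?thesis using c G(2) by auto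
  qed
  then have "\<Inter>\<A> = {c. \<forall>p\<in>F. p c = 0}" by (auto simp: F_def)
  moreover have "\<forall>p\<in>F. polynomial_fun p" by (simp add: F_def)
  ultimately show ?thesis unfolding Zariski_closed_def by (intro exI[of _ F] conjI)
qed

lemma closure_subset_Zariski_closure:
  fixes S :: "(complex, 'n::finite) structure_constants set"
  shows "closure S \<subseteq> Zariski_closure S"
proof -
  have "Zariski_closed (Zariski_closure S)"
    unfolding Zariski_closure_def hull_def by (rule Zariski_closed_Inter) auto
  then show ?thesis
    by (intro closure_minimal Zariski_closed_imp_closed) (simp_all add: Zariski_closure_def hull_subset)
qed

text \<open>
  The action of a single matrix is linear in the structure constants, hence continuous, so it maps the
  closure of an orbit into itself.
\<close>
lemma GL_orbit_subset_closure:
  fixes c :: "(complex, 'n::finite) structure_constants"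
  assumes "d \<in> closure (GL_orbit c)"
  shows "GL_orbit d \<subseteq> closure (GL_orbit c)"
proof
  fix e assume "e \<in> GL_orbit d"
  then obtain g where g: "invertible g" and e: "e = GL_act g d" by (auto simp: GL_orbit_def)
  have "continuous_on UNIV (\<lambda>c :: (complex, 'n) structure_constants. (g *v alg_mult c x y) $ k)" for x y k
    unfolding alg_mult_def matrix_vector_mult_def sum_component vector_smult_component vec_lambda_beta
    by (intro continuous_intros)
  then have "continuous_on UNIV (\<lambda>c :: (complex, 'n) structure_constants. \<chi> k. (g *v alg_mult c x y) $ k)"
    for x y
    by (rule continuous_on_vec_lambda)
  then have "continuous_on UNIV (GL_act g)"
    unfolding GL_act_def structure_constants_of_def vec_lambda_eta
    by (intro continuous_on_vec_lambda)
  moreover have "GL_act g ` GL_orbit c \<subseteq> closure (GL_orbit c)"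
    using g by (intro order_trans[OF _ closure_subset])
      (auto simp: GL_orbit_def GL_act_GL_act intro: invertible_mult)
  ultimately have "GL_act g ` closure (GL_orbit c) \<subseteq> closure (GL_orbit c)"
    by (intro image_closure_subset) (auto intro: continuous_on_subset)
  then show "e \<in> closure (GL_orbit c)" using assms e by blast
qed

lemma closure_GL_orbit_trans:
  fixes c :: "(complex, 'n::finite) structure_constants"
  assumes "d \<in> closure (GL_orbit c)" "e \<in> closure (GL_orbit d)"
  shows "e \<in> closure (GL_orbit c)"
  using closure_minimal[OF GL_orbit_subset_closure[OF assms(1)]] assms(2) by auto

lemma tendsto_alg2:
  assumes "(u \<longlongrightarrow> u') F" "(v \<longlongrightarrow> v') F" "(w \<longlongrightarrow> w') F" "(z \<longlongrightarrow> z') F"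
  shows "((\<lambda>t. alg2 (u t) (v t) (w t) (z t)) \<longlongrightarrow> alg2 u' v' w' z') F"
proof -
  have "((\<lambda>t. alg2 (u t) (v t) (w t) (z t) $ i $ j) \<longlongrightarrow> alg2 u' v' w' z' $ i $ j) F" for i j
    using exhaust_2[of i] exhaust_2[of j] assms by (elim disjE) simp_all
  then have "((\<lambda>t. alg2 (u t) (v t) (w t) (z t) $ i) \<longlongrightarrow> alg2 u' v' w' z' $ i) F" for i
    by (rule vec_tendstoI)
  then show ?thesis by (rule vec_tendstoI)
qed

lemma isCont_componentwise:
  assumes "\<And>i. isCont (\<lambda>t. f t $ i) x"
  shows "isCont f x"
  using assms unfolding isCont_def by (intro vec_tendstoI)

lemma isCont_vector_2:
  fixes a b :: "complex \<Rightarrow> complex"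
  assumes "isCont a x" "isCont b x"
  shows "isCont (\<lambda>t. vector [a t, b t] :: complex ^ 2) x"
proof (rule isCont_componentwise)
  show "isCont (\<lambda>t. (vector [a t, b t] :: complex ^ 2) $ i) x" for i
    using exhaust_2[of i] assms by (elim disjE) simp_all
qed

text \<open>
  The basis \<open>(f t, h t)\<close> may collapse or blow up as \<open>t\<close> tends to \<open>0\<close>; only its
  multiplication table has to converge.
\<close>
lemma limit_of_tables_mem_closure:
  fixes f h :: "complex \<Rightarrow> complex ^ 2"
  assumes "\<And>t. t \<noteq> 0 \<Longrightarrow> f t $ 1 * h t $ 2 \<noteq> f t $ 2 * h t $ 1"
    and "\<And>t. t \<noteq> 0 \<Longrightarrow> alg_mult c (f t) (f t) = u t $ 1 *s f t + u t $ 2 *s h t"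
    and "\<And>t. t \<noteq> 0 \<Longrightarrow> alg_mult c (f t) (h t) = v t $ 1 *s f t + v t $ 2 *s h t"
    and "\<And>t. t \<noteq> 0 \<Longrightarrow> alg_mult c (h t) (f t) = w t $ 1 *s f t + w t $ 2 *s h t"
    and "\<And>t. t \<noteq> 0 \<Longrightarrow> alg_mult c (h t) (h t) = z t $ 1 *s f t + z t $ 2 *s h t"
    and cont: "isCont u 0" "isCont v 0" "isCont w 0" "isCont z 0"
  shows "alg2 (u 0) (v 0) (w 0) (z 0) \<in> closure (GL_orbit c)"
proof -
  have "alg2 (u t) (v t) (w t) (z t) \<in> GL_orbit c" if "t \<noteq> 0" for t
    using assms(1-5)[OF that] by (rule table_in_basis_mem_GL_orbit)
  then have "eventually (\<lambda>t. alg2 (u t) (v t) (w t) (z t) \<in> closure (GL_orbit c)) (at 0)"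
    by (simp add: eventually_at_filter subsetD[OF closure_subset])
  moreover have "((\<lambda>t. alg2 (u t) (v t) (w t) (z t)) \<longlongrightarrow> alg2 (u 0) (v 0) (w 0) (z 0)) (at 0)"
    using cont by (intro tendsto_alg2) (simp_all add: isCont_def)
  ultimately show ?thesis
    by (intro Lim_in_closed_set[OF closed_closure]) auto
qed

lemma A\<^sub>1_mem_closure: "A\<^sub>1 \<in> closure (GL_orbit c)"
proof -
  have "alg2 (0 *s (c $ 1 $ 1)) (0 *s (c $ 1 $ 2)) (0 *s (c $ 2 $ 1)) (0 *s (c $ 2 $ 2))
      \<in> closure (GL_orbit c)"
    by (rule limit_of_tables_mem_closure[where f = "\<lambda>t. t *s e\<^sub>1" and h = "\<lambda>t. t *s e\<^sub>2"
          and u = "\<lambda>t. t *s (c $ 1 $ 1)" and v = "\<lambda>t. t *s (c $ 1 $ 2)"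
          and w = "\<lambda>t. t *s (c $ 2 $ 1)" and z = "\<lambda>t. t *s (c $ 2 $ 2)"])
      (simp_all add: alg_mult_scale_left alg_mult_scale_right alg_mult_axis vec_eq_iff forall_2,
        (rule isCont_componentwise, simp)+)
  then show ?thesis by (simp add: A\<^sub>1_def)
qed

lemma basis_coordinates:
  fixes f h v :: "complex ^ 2"
  assumes "f $ 1 * h $ 2 \<noteq> f $ 2 * h $ 1"
  obtains w :: "complex ^ 2" where "v = w $ 1 *s f + w $ 2 *s h"
proof -
  define D where "D = f $ 1 * h $ 2 - f $ 2 * h $ 1"
  have D: "D \<noteq> 0" using assms by (simp add: D_def)
  define w :: "complex ^ 2" where
    "w = vector [(v $ 1 * h $ 2 - v $ 2 * h $ 1) / D, (f $ 1 * v $ 2 - f $ 2 * v $ 1) / D]"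
  have "v $ 1 * D = (v $ 1 * h $ 2 - v $ 2 * h $ 1) * f $ 1 + (f $ 1 * v $ 2 - f $ 2 * v $ 1) * h $ 1"
    "v $ 2 * D = (v $ 1 * h $ 2 - v $ 2 * h $ 1) * f $ 2 + (f $ 1 * v $ 2 - f $ 2 * v $ 1) * h $ 2"
    by (simp_all add: D_def algebra_simps)
  then have "v $ 1 = ((v $ 1 * h $ 2 - v $ 2 * h $ 1) * f $ 1 + (f $ 1 * v $ 2 - f $ 2 * v $ 1) * h $ 1) / D"
    "v $ 2 = ((v $ 1 * h $ 2 - v $ 2 * h $ 1) * f $ 2 + (f $ 1 * v $ 2 - f $ 2 * v $ 1) * h $ 2) / D"
    using D by (simp_all only: eq_divide_eq if_False not_False_eq_True if_True)
  then have "v = w $ 1 *s f + w $ 2 *s h"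
    by (simp add: vec_eq_iff forall_2 w_def add_divide_distrib)
  then show ?thesis by (rule that)
qed

text \<open>
  The vectors \<open>t\<^sup>2 x\<^sup>2\<close> and \<open>t x\<close> form a basis. Every product of the two other than the square of
  \<open>t x\<close> has degree at least \<open>3\<close> in \<open>t\<close>, which exceeds the degree of both basis vectors,
  so its coordinates tend to \<open>0\<close>.
\<close>
lemma A\<^sub>5_mem_closure:
  assumes "x $ 1 * alg_mult c x x $ 2 \<noteq> x $ 2 * alg_mult c x x $ 1"
  shows "A\<^sub>5 \<in> closure (GL_orbit c)"
proof -
  define y where "y = alg_mult c x x"
  have indep: "y $ 1 * x $ 2 \<noteq> y $ 2 * x $ 1" using assms by (simp add: y_def algebra_simps)
  obtain u :: "complex ^ 2" where u: "alg_mult c y y = u $ 1 *s y + u $ 2 *s x"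
    using basis_coordinates[OF indep] by blast
  obtain v :: "complex ^ 2" where v: "alg_mult c y x = v $ 1 *s y + v $ 2 *s x"
    using basis_coordinates[OF indep] by blast
  obtain w :: "complex ^ 2" where w: "alg_mult c x y = w $ 1 *s y + w $ 2 *s x"
    using basis_coordinates[OF indep] by blast
  have "alg2 (vector [0\<^sup>2 * u $ 1, 0 ^ 3 * u $ 2]) (vector [0 * v $ 1, 0\<^sup>2 * v $ 2])
     (vector [0 * w $ 1, 0\<^sup>2 * w $ 2]) e\<^sub>1 \<in> closure (GL_orbit c)"
  proof (rule limit_of_tables_mem_closure[where f = "\<lambda>t. t\<^sup>2 *s y" and h = "\<lambda>t. t *s x"
        and u = "\<lambda>t. vector [t\<^sup>2 * u $ 1, t ^ 3 * u $ 2]"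
        and v = "\<lambda>t. vector [t * v $ 1, t\<^sup>2 * v $ 2]"
        and w = "\<lambda>t. vector [t * w $ 1, t\<^sup>2 * w $ 2]" and z = "\<lambda>t. e\<^sub>1"])
    fix t :: complex assume t: "t \<noteq> 0"
    show "(t\<^sup>2 *s y) $ 1 * (t *s x) $ 2 \<noteq> (t\<^sup>2 *s y) $ 2 * (t *s x) $ 1"
      using t indep by (simp add: algebra_simps)
  qed (auto simp: alg_mult_scale_left alg_mult_scale_right u v w y_def[symmetric] vec_eq_iff
      power2_eq_square power3_eq_cube algebra_simps intro!: isCont_vector_2 continuous_intros)
  moreover have "vector [0, 0] = (0 :: complex ^ 2)" by (simp add: vec_eq_iff forall_2)
  ultimately show ?thesis by (simp add: A\<^sub>5_def)
qed

lemma vector_00: "vector [0, 0] = (0 :: complex ^ 2)"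
  and vector_01: "vector [0, 1] = e\<^sub>2"
  by (simp_all add: vec_eq_iff forall_2)

lemma A\<^sub>2_mem_closure_A\<^sub>3: "A\<^sub>2 \<in> closure (GL_orbit A\<^sub>3)"
proof -
  have "alg2 e\<^sub>1 0 0 (vector [0, 0]) \<in> closure (GL_orbit A\<^sub>3)"
    by (rule limit_of_tables_mem_closure[where f = "\<lambda>t. e\<^sub>1" and h = "\<lambda>t. t *s e\<^sub>2"
          and u = "\<lambda>t. e\<^sub>1" and v = "\<lambda>t. 0" and w = "\<lambda>t. 0" and z = "\<lambda>t. vector [0, t]"])
      (auto simp: A\<^sub>3_def alg_mult_2 vec_eq_iff forall_2 intro!: isCont_vector_2 continuous_intros)
  then show ?thesis by (simp add: A\<^sub>2_def vector_00)
qed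

lemma A\<^sub>4_mem_closure_A\<^sub>3: "A\<^sub>4 \<in> closure (GL_orbit A\<^sub>3)"
proof -
  have "alg2 (vector [0, 0]) e\<^sub>1 e\<^sub>1 e\<^sub>2 \<in> closure (GL_orbit A\<^sub>3)"
    by (rule limit_of_tables_mem_closure[where f = "\<lambda>t. t *s e\<^sub>1" and h = "\<lambda>t. e\<^sub>1 + e\<^sub>2"
          and u = "\<lambda>t. vector [t, 0]" and v = "\<lambda>t. e\<^sub>1" and w = "\<lambda>t. e\<^sub>1" and z = "\<lambda>t. e\<^sub>2"])
      (auto simp: A\<^sub>3_def alg_mult_2 vec_eq_iff forall_2 intro!: isCont_vector_2 continuous_intros)
  then show ?thesis by (simp add: A\<^sub>4_def vector_00)
qed

lemma B\<^sub>1_mem_closure_B\<^sub>4: "B\<^sub>1 (-2) \<in> closure (GL_orbit B\<^sub>4)"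
proof -
  have "alg2 (vector [0, 0\<^sup>2]) 0 (- e\<^sub>1) ((-2) *s e\<^sub>2) \<in> closure (GL_orbit B\<^sub>4)"
    by (rule limit_of_tables_mem_closure[where f = "\<lambda>t. t *s e\<^sub>1" and h = "\<lambda>t. e\<^sub>2"
          and u = "\<lambda>t. vector [0, t\<^sup>2]" and v = "\<lambda>t. 0" and w = "\<lambda>t. - e\<^sub>1"
          and z = "\<lambda>t. (-2) *s e\<^sub>2"])
      (auto simp: B\<^sub>4_def alg_mult_2 vec_eq_iff forall_2 power2_eq_square
        intro!: isCont_vector_2 continuous_intros)
  then show ?thesis by (simp add: B\<^sub>1_def vector_00)
qed

text \<open>
  In \<open>B\<^sub>2 (-1)\<close> right multiplication by \<open>e\<^sub>2\<close> has determinant \<open>1\<close> and trace \<open>-2\<close>. The element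
  \<open>e\<^sub>1 + e\<^sub>2\<close> of \<open>B\<^sub>4\<close> has the same determinant and trace and can therefore serve as second basis vector.
\<close>
lemma B\<^sub>2_mem_closure_B\<^sub>4: "B\<^sub>2 (-1) \<in> closure (GL_orbit B\<^sub>4)"
proof -
  have "alg2 (vector [- 0, 0\<^sup>2]) (vector [-1, 0]) (vector [-2, 0]) (- e\<^sub>2) \<in> closure (GL_orbit B\<^sub>4)"
    by (rule limit_of_tables_mem_closure[where f = "\<lambda>t. t *s e\<^sub>1" and h = "\<lambda>t. e\<^sub>1 + e\<^sub>2"
          and u = "\<lambda>t. vector [- t, t\<^sup>2]" and v = "\<lambda>t. vector [-1, t]"
          and w = "\<lambda>t. vector [-2, t]" and z = "\<lambda>t. - e\<^sub>2"])
      (auto simp: B\<^sub>4_def alg_mult_2 vec_eq_iff forall_2 power2_eq_square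
        intro!: isCont_vector_2 continuous_intros)
  also have "alg2 (vector [- 0, 0\<^sup>2]) (vector [-1, 0]) (vector [-2, 0]) (- e\<^sub>2) = B\<^sub>2 (-1)"
    by (simp add: B\<^sub>2_def vec_eq_iff forall_2)
  finally show ?thesis .
qed

lemma B\<^sub>1_mem_closure_B\<^sub>3: "B\<^sub>1 (-1) \<in> closure (GL_orbit B\<^sub>3)"
proof -
  have "alg2 0 0 (- e\<^sub>1) (vector [0, -1]) \<in> closure (GL_orbit B\<^sub>3)"
    by (rule limit_of_tables_mem_closure[where f = "\<lambda>t. inverse t *s e\<^sub>1" and h = "\<lambda>t. e\<^sub>2"
          and u = "\<lambda>t. 0" and v = "\<lambda>t. 0" and w = "\<lambda>t. - e\<^sub>1" and z = "\<lambda>t. vector [t, -1]"])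
      (auto simp: B\<^sub>3_def alg_mult_2 vec_eq_iff forall_2 intro!: isCont_vector_2 continuous_intros)
  also have "alg2 0 0 (- e\<^sub>1) (vector [0, -1]) = B\<^sub>1 (-1)"
    by (simp add: B\<^sub>1_def vec_eq_iff forall_2)
  finally show ?thesis .
qed

lemma B\<^sub>2_mem_closure_B\<^sub>5: "B\<^sub>2 1 \<in> closure (GL_orbit B\<^sub>5)"
proof -
  have "alg2 0 e\<^sub>1 0 (vector [0, 1]) \<in> closure (GL_orbit B\<^sub>5)"
    by (rule limit_of_tables_mem_closure[where f = "\<lambda>t. inverse t *s e\<^sub>1" and h = "\<lambda>t. e\<^sub>2"
          and u = "\<lambda>t. 0" and v = "\<lambda>t. e\<^sub>1" and w = "\<lambda>t. 0" and z = "\<lambda>t. vector [t, 1]"])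
      (auto simp: B\<^sub>5_def alg_mult_2 vec_eq_iff forall_2 intro!: isCont_vector_2 continuous_intros)
  then show ?thesis by (simp add: B\<^sub>2_def vector_01)
qed

section \<open>Invariant closed conditions\<close>

text \<open>
  The two properties that make a condition an obstruction: if the orbit of \<open>c\<close> satisfies it, so does
  its Zariski closure.
\<close>
definition closed_invariant :: "(('k::field, 'n::finite) structure_constants \<Rightarrow> bool) \<Rightarrow> bool" where
  "closed_invariant P \<longleftrightarrow>
     Zariski_closed {c. P c} \<and> (\<forall>g c. invertible g \<longrightarrow> P c \<longrightarrow> P (GL_act g c))"

lemma closed_invariant_GL_orbit:
  assumes "closed_invariant P" "d \<in> GL_orbit c"
  shows "P d \<longleftrightarrow> P c"
proof -
  have "P d" if "d \<in> GL_orbit c" "P c" for c d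
    using that assms(1) by (auto simp: closed_invariant_def GL_orbit_def)
  then show ?thesis using assms(2) GL_orbit_sym[OF assms(2)] by blast
qed

lemma closed_invariant_Zariski_closure:
  assumes "closed_invariant P" "P c" "d \<in> Zariski_closure (GL_orbit c)"
  shows "P d"
proof -
  have "Zariski_closure (GL_orbit c) \<subseteq> {c. P c}"
    unfolding Zariski_closure_def
    using assms(1,2) closed_invariant_GL_orbit[OF assms(1)]
    by (intro hull_minimal) (auto simp: closed_invariant_def)
  then show ?thesis using assms(3) by blast
qed

lemma Zariski_closed_Collect_all:
  assumes "\<And>i. Zariski_closed {c. P i c}"
  shows "Zariski_closed {c. \<forall>i. P i c}"
proof -
  have "{c. \<forall>i. P i c} = \<Inter> (range (\<lambda>i. {c. P i c}))" by auto
  then show ?thesis using assms by (auto intro: Zariski_closed_Inter)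
qed

lemma Zariski_closed_Collect_eq:
  assumes "polynomial_fun p" "polynomial_fun q"
  shows "Zariski_closed {c. p c = q c}"
  unfolding Zariski_closed_def
  using polynomial_fun_diff[OF assms] by (intro exI[of _ "{\<lambda>c. p c - q c}"]) auto

lemma Zariski_closed_Collect_vec_eq:
  assumes "\<And>i. polynomial_fun (\<lambda>c. f c $ i)" "\<And>i. polynomial_fun (\<lambda>c. h c $ i)"
  shows "Zariski_closed {c. f c = h c}"
  unfolding vec_eq_iff by (intro Zariski_closed_Collect_all Zariski_closed_Collect_eq assms)

lemma polynomial_fun_product: "polynomial_fun (\<lambda>c. alg_mult c x y $ k)"
  by (intro polynomial_fun_alg_mult polynomial_fun.const)

definition left_mult ::
    "('k::field, 'n::finite) structure_constants \<Rightarrow> 'k ^ 'n \<Rightarrow> 'k ^ 'n ^ 'n" where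
  "left_mult c x = matrix (\<lambda>y. alg_mult c x y)"

definition right_mult ::
    "('k::field, 'n::finite) structure_constants \<Rightarrow> 'k ^ 'n \<Rightarrow> 'k ^ 'n ^ 'n" where
  "right_mult c x = matrix (\<lambda>y. alg_mult c y x)"

lemma left_mult_vec: "left_mult c x *v y = alg_mult c x y"
  unfolding left_mult_def
  by (rule matrix_works) (unfold_locales, simp_all add: alg_mult_add_right alg_mult_scale_right)

lemma right_mult_vec: "right_mult c x *v y = alg_mult c y x"
  unfolding right_mult_def
  by (rule matrix_works) (unfold_locales, simp_all add: alg_mult_add_left alg_mult_scale_left)

lemma left_mult_GL_act:
  "left_mult (GL_act g c) x = g ** left_mult c (matrix_inv g *v x) ** matrix_inv g"
  by (simp add: matrix_eq left_mult_vec alg_mult_GL_act flip: matrix_vector_mul_assoc)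

lemma right_mult_GL_act:
  "right_mult (GL_act g c) x = g ** right_mult c (matrix_inv g *v x) ** matrix_inv g"
  by (simp add: matrix_eq right_mult_vec alg_mult_GL_act flip: matrix_vector_mul_assoc)

lemma trace_conjugate:
  fixes A g :: "'k::field ^ 'n::finite ^ 'n"
  assumes "invertible g"
  shows "trace (g ** A ** matrix_inv g) = trace A"
proof -
  have "trace (g ** A ** matrix_inv g) = trace (matrix_inv g ** (g ** A))"
    by (rule trace_mul_sym)
  then show ?thesis by (simp add: matrix_mul_assoc matrix_inv_mult assms)
qed

lemma det_conjugate:
  fixes A g :: "'k::field ^ 'n::finite ^ 'n"
  assumes "invertible g"
  shows "det (g ** A ** matrix_inv g) = det A"
proof -
  have "det g * det (matrix_inv g) = det (mat 1 :: 'k ^ 'n ^ 'n)"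
    by (simp only: matrix_inv_mult(1)[OF assms] flip: det_mul)
  then show ?thesis by (simp add: det_mul algebra_simps)
qed

lemmas conjugation_simps =
  left_mult_GL_act right_mult_GL_act trace_conjugate det_conjugate alg_mult_GL_act

lemma polynomial_fun_left_mult: "polynomial_fun (\<lambda>c. left_mult c x $ i $ j)"
  unfolding left_mult_def matrix_def vec_lambda_beta by (rule polynomial_fun_product)

lemma polynomial_fun_right_mult: "polynomial_fun (\<lambda>c. right_mult c x $ i $ j)"
  unfolding right_mult_def matrix_def vec_lambda_beta by (rule polynomial_fun_product)

lemma polynomial_fun_trace:
  "polynomial_fun (\<lambda>c. trace (left_mult c x))" "polynomial_fun (\<lambda>c. trace (right_mult c x))"
  unfolding trace_def
  by (intro polynomial_fun_sum polynomial_fun_left_mult polynomial_fun_right_mult)+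

lemma polynomial_fun_det_2:
  "polynomial_fun (\<lambda>c :: ('k::field, 2) structure_constants. det (left_mult c x))"
  "polynomial_fun (\<lambda>c :: ('k::field, 2) structure_constants. det (right_mult c x))"
  unfolding det_2
  by (intro polynomial_fun_diff polynomial_fun.mult polynomial_fun_left_mult
      polynomial_fun_right_mult)+

lemmas polynomial_intros = polynomial_fun_product polynomial_fun_trace polynomial_fun_det_2
  polynomial_fun_diff polynomial_fun.const polynomial_fun.add polynomial_fun.mult

definition commutative :: "('k::field, 'n::finite) structure_constants \<Rightarrow> bool" where
  "commutative c \<longleftrightarrow> (\<forall>x y. alg_mult c x y = alg_mult c y x)"

text \<open>
  The difference of the traces is, up to sign, the trace of \<open>x\<close> in the adjoint representation of the
  associated Lie algebra. For a noncommutative algebra of dimension two it is a nonzero linear form.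
\<close>
definition trace_relation :: "'k \<Rightarrow> ('k::field, 'n::finite) structure_constants \<Rightarrow> bool" where
  "trace_relation k c \<longleftrightarrow>
     (\<forall>x. trace (right_mult c x) = k * (trace (right_mult c x) - trace (left_mult c x)))"

text \<open>
  Where the difference of traces is a nonzero linear form, this says that left multiplication by the
  elements of its kernel vanishes; in a basis with \<open>[e\<^sub>1, e\<^sub>2] = e\<^sub>1\<close> the kernel is spanned by \<open>e\<^sub>1\<close>.
  Multiplying out the kernel condition makes it polynomial.
\<close>
definition left_mult_proportional :: "('k::field, 'n::finite) structure_constants \<Rightarrow> bool" where
  "left_mult_proportional c \<longleftrightarrow>
     (\<forall>x y z. (trace (right_mult c x) - trace (left_mult c x)) *s alg_mult c y z =
        (trace (right_mult c y) - trace (left_mult c y)) *s alg_mult c x z)"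

text \<open>
  The discriminant of the characteristic polynomial of right multiplication by \<open>x\<close> vanishes.
\<close>
definition right_mult_double_eigenvalue :: "('k::field, 2) structure_constants \<Rightarrow> bool" where
  "right_mult_double_eigenvalue c \<longleftrightarrow>
     (\<forall>x. trace (right_mult c x) * trace (right_mult c x) = 4 * det (right_mult c x))"

text \<open>
  The scalar by which a multiplication acts has to be half its trace, which turns "acts as
  some scalar" into a polynomial equation.
\<close>
definition left_mult_scalar :: "('k::field, 2) structure_constants \<Rightarrow> bool" where
  "left_mult_scalar c \<longleftrightarrow> (\<forall>x y. 2 *s alg_mult c x y = trace (left_mult c x) *s y)"

definition right_mult_scalar :: "('k::field, 2) structure_constants \<Rightarrow> bool" where
  "right_mult_scalar c \<longleftrightarrow> (\<forall>x y. 2 *s alg_mult c x y = trace (right_mult c y) *s x)"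

definition left_mult_singular :: "('k::field, 2) structure_constants \<Rightarrow> bool" where
  "left_mult_singular c \<longleftrightarrow> (\<forall>x. det (left_mult c x) = 0)"

lemma closed_invariant_commutative: "closed_invariant commutative"
  unfolding closed_invariant_def commutative_def
  by (auto simp: alg_mult_GL_act
      intro!: Zariski_closed_Collect_all Zariski_closed_Collect_vec_eq polynomial_intros)

lemma closed_invariant_trace_relation: "closed_invariant (trace_relation k)"
  unfolding closed_invariant_def trace_relation_def
  by (auto simp: conjugation_simps
      intro!: Zariski_closed_Collect_all Zariski_closed_Collect_eq polynomial_intros)

lemma closed_invariant_left_mult_proportional: "closed_invariant left_mult_proportional"
  unfolding closed_invariant_def left_mult_proportional_def
proof (intro conjI allI impI)
  show "Zariski_closed {c :: ('a, 'b) structure_constants. \<forall>x y z.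
      (trace (right_mult c x) - trace (left_mult c x)) *s alg_mult c y z =
      (trace (right_mult c y) - trace (left_mult c y)) *s alg_mult c x z}"
    by (intro Zariski_closed_Collect_all Zariski_closed_Collect_vec_eq)
      (simp_all, (intro polynomial_intros)+)
qed (simp add: conjugation_simps flip: vec.scale)

lemma closed_invariant_right_mult_double_eigenvalue: "closed_invariant right_mult_double_eigenvalue"
  unfolding closed_invariant_def right_mult_double_eigenvalue_def
  by (auto simp: conjugation_simps
      intro!: Zariski_closed_Collect_all Zariski_closed_Collect_eq polynomial_intros)

lemma closed_invariant_left_mult_singular: "closed_invariant left_mult_singular"
  unfolding closed_invariant_def left_mult_singular_def
  by (auto simp: conjugation_simps
      intro!: Zariski_closed_Collect_all Zariski_closed_Collect_eq polynomial_intros)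

lemma mult_matrix_inv_vec: "invertible g \<Longrightarrow> g *v (matrix_inv g *v x) = x"
  by (simp add: matrix_vector_mul_assoc matrix_inv_mult)

lemma closed_invariant_left_mult_scalar: "closed_invariant left_mult_scalar"
  unfolding closed_invariant_def left_mult_scalar_def
proof (intro conjI allI impI)
  show "Zariski_closed {c :: ('a, 2) structure_constants. \<forall>x y.
      2 *s alg_mult c x y = trace (left_mult c x) *s y}"
    by (intro Zariski_closed_Collect_all Zariski_closed_Collect_vec_eq)
      (simp_all, (intro polynomial_intros)+)
qed (simp add: conjugation_simps mult_matrix_inv_vec vec.scale flip: vec.scale[of _ 2])

lemma closed_invariant_right_mult_scalar: "closed_invariant right_mult_scalar"
  unfolding closed_invariant_def right_mult_scalar_def
proof (intro conjI allI impI)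
  show "Zariski_closed {c :: ('a, 2) structure_constants. \<forall>x y.
      2 *s alg_mult c x y = trace (right_mult c y) *s x}"
    by (intro Zariski_closed_Collect_all Zariski_closed_Collect_vec_eq)
      (simp_all, (intro polynomial_intros)+)
qed (simp add: conjugation_simps mult_matrix_inv_vec vec.scale flip: vec.scale[of _ 2])

section \<open>Which algebras satisfy which conditions\<close>

lemma trace_left_mult_2:
  "trace (left_mult (c :: ('k::field, 2) structure_constants) x) =
     x $ 1 * (c $ 1 $ 1 $ 1 + c $ 1 $ 2 $ 2) + x $ 2 * (c $ 2 $ 1 $ 1 + c $ 2 $ 2 $ 2)"
  by (simp add: trace_def sum_2 left_mult_def matrix_def alg_mult_2 algebra_simps)

lemma trace_right_mult_2:
  "trace (right_mult (c :: ('k::field, 2) structure_constants) x) =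
     x $ 1 * (c $ 1 $ 1 $ 1 + c $ 2 $ 1 $ 2) + x $ 2 * (c $ 1 $ 2 $ 1 + c $ 2 $ 2 $ 2)"
  by (simp add: trace_def sum_2 right_mult_def matrix_def alg_mult_2 algebra_simps)

lemma det_left_mult_2:
  "det (left_mult (c :: ('k::field, 2) structure_constants) x) =
     (x $ 1 * c $ 1 $ 1 $ 1 + x $ 2 * c $ 2 $ 1 $ 1) * (x $ 1 * c $ 1 $ 2 $ 2 + x $ 2 * c $ 2 $ 2 $ 2) -
     (x $ 1 * c $ 1 $ 2 $ 1 + x $ 2 * c $ 2 $ 2 $ 1) * (x $ 1 * c $ 1 $ 1 $ 2 + x $ 2 * c $ 2 $ 1 $ 2)"
  by (simp add: det_2 left_mult_def matrix_def alg_mult_2)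

lemma det_right_mult_2:
  "det (right_mult (c :: ('k::field, 2) structure_constants) x) =
     (x $ 1 * c $ 1 $ 1 $ 1 + x $ 2 * c $ 1 $ 2 $ 1) * (x $ 1 * c $ 2 $ 1 $ 2 + x $ 2 * c $ 2 $ 2 $ 2) -
     (x $ 1 * c $ 2 $ 1 $ 1 + x $ 2 * c $ 2 $ 2 $ 1) * (x $ 1 * c $ 1 $ 1 $ 2 + x $ 2 * c $ 1 $ 2 $ 2)"
  by (simp add: det_2 right_mult_def matrix_def alg_mult_2)

lemmas algebra_defs = A\<^sub>1_def A\<^sub>2_def A\<^sub>3_def A\<^sub>4_def A\<^sub>5_def B\<^sub>1_def B\<^sub>2_def B\<^sub>3_def B\<^sub>4_def B\<^sub>5_def

lemma commutative_2:
  "commutative (c :: ('k::field, 2) structure_constants) \<longleftrightarrow> c $ 1 $ 2 = c $ 2 $ 1"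
proof
  assume "commutative c"
  then show "c $ 1 $ 2 = c $ 2 $ 1"
    using alg_mult_axis[of c] unfolding commutative_def by metis
qed (simp add: commutative_def alg_mult_2 algebra_simps)

lemma commutative_table:
  "commutative A\<^sub>1" "commutative A\<^sub>2" "commutative A\<^sub>3" "commutative A\<^sub>4" "commutative A\<^sub>5"
  "\<not> commutative (B\<^sub>1 \<alpha>)" "\<not> commutative (B\<^sub>2 \<beta>)"
  "\<not> commutative B\<^sub>3" "\<not> commutative B\<^sub>4" "\<not> commutative B\<^sub>5"
  by (auto simp: commutative_2 algebra_defs vec_eq_iff forall_2 algebra_simps)

lemma trace_relation_2:
  "trace_relation k (c :: (complex, 2) structure_constants) \<longleftrightarrow>
     c $ 1 $ 1 $ 1 + c $ 2 $ 1 $ 2 = k * (c $ 2 $ 1 $ 2 - c $ 1 $ 2 $ 2) \<and>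
     c $ 1 $ 2 $ 1 + c $ 2 $ 2 $ 2 = k * (c $ 1 $ 2 $ 1 - c $ 2 $ 1 $ 1)"
    (is "?L \<longleftrightarrow> ?R")
proof
  assume ?L
  from this[unfolded trace_relation_def trace_left_mult_2 trace_right_mult_2, rule_format, of e\<^sub>1]
    this[unfolded trace_relation_def trace_left_mult_2 trace_right_mult_2, rule_format, of e\<^sub>2]
  show ?R by simp
next
  assume R: ?R
  have "k * (trace (right_mult c x) - trace (left_mult c x)) =
      x $ 1 * (k * (c $ 2 $ 1 $ 2 - c $ 1 $ 2 $ 2)) + x $ 2 * (k * (c $ 1 $ 2 $ 1 - c $ 2 $ 1 $ 1))" for x
    by (simp add: trace_left_mult_2 trace_right_mult_2 algebra_simps)
  then show ?L
    using R by (simp add: trace_relation_def trace_right_mult_2)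
qed

lemma trace_relation_table:
  "trace_relation k A\<^sub>1" "\<not> trace_relation k A\<^sub>2" "\<not> trace_relation k A\<^sub>3" "\<not> trace_relation k A\<^sub>4"
  "trace_relation k A\<^sub>5" "trace_relation k (B\<^sub>1 \<alpha>) \<longleftrightarrow> \<alpha> = k" "trace_relation k (B\<^sub>2 \<beta>) \<longleftrightarrow> 2 * \<beta> = k"
  "trace_relation k B\<^sub>3 \<longleftrightarrow> k = -1" "trace_relation k B\<^sub>4 \<longleftrightarrow> k = -2" "trace_relation k B\<^sub>5 \<longleftrightarrow> k = 2"
  by (auto simp: trace_relation_2 algebra_defs)

lemma left_mult_proportional_table:
  "left_mult_proportional (B\<^sub>1 \<alpha>)" "left_mult_proportional B\<^sub>3"
  "\<beta> \<noteq> 0 \<Longrightarrow> \<not> left_mult_proportional (B\<^sub>2 \<beta>)" "\<not> left_mult_proportional B\<^sub>4"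
  "\<not> left_mult_proportional B\<^sub>5"
proof -
  have L: "left_mult_proportional c \<Longrightarrow>
      (trace (right_mult c e\<^sub>1) - trace (left_mult c e\<^sub>1)) *s (c $ 2 $ i) =
        (trace (right_mult c e\<^sub>2) - trace (left_mult c e\<^sub>2)) *s (c $ 1 $ i)" for c i
    unfolding left_mult_proportional_def by (metis alg_mult_axis)
  show "left_mult_proportional (B\<^sub>1 \<alpha>)" "left_mult_proportional B\<^sub>3"
    by (simp_all add: left_mult_proportional_def trace_left_mult_2 trace_right_mult_2 alg_mult_2
        algebra_defs vec_eq_iff forall_2 algebra_simps)
  show "\<beta> \<noteq> 0 \<Longrightarrow> \<not> left_mult_proportional (B\<^sub>2 \<beta>)" "\<not> left_mult_proportional B\<^sub>5"
    by (auto dest!: L[of _ 2] simp: trace_left_mult_2 trace_right_mult_2 algebra_defs vec_eq_iff forall_2)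
  show "\<not> left_mult_proportional B\<^sub>4"
    by (auto dest!: L[of _ 1] simp: trace_left_mult_2 trace_right_mult_2 algebra_defs vec_eq_iff forall_2)
qed

lemma right_mult_double_eigenvalue_table:
  "right_mult_double_eigenvalue A\<^sub>1" "\<not> right_mult_double_eigenvalue A\<^sub>2"
  "\<not> right_mult_double_eigenvalue A\<^sub>3" "right_mult_double_eigenvalue A\<^sub>4"
  "right_mult_double_eigenvalue A\<^sub>5" "\<alpha> \<noteq> 0 \<Longrightarrow> \<not> right_mult_double_eigenvalue (B\<^sub>1 \<alpha>)"
  "right_mult_double_eigenvalue (B\<^sub>2 \<beta>)" "\<not> right_mult_double_eigenvalue B\<^sub>3"
  "\<not> right_mult_double_eigenvalue B\<^sub>4" "right_mult_double_eigenvalue B\<^sub>5"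
proof -
  have D: "right_mult_double_eigenvalue c \<Longrightarrow>
      trace (right_mult c x) * trace (right_mult c x) = 4 * det (right_mult c x)"
    for c :: "(complex, 2) structure_constants" and x
    unfolding right_mult_double_eigenvalue_def by blast
  show "right_mult_double_eigenvalue A\<^sub>1" "right_mult_double_eigenvalue A\<^sub>4"
    "right_mult_double_eigenvalue A\<^sub>5" "right_mult_double_eigenvalue (B\<^sub>2 \<beta>)"
    "right_mult_double_eigenvalue B\<^sub>5"
    by (simp_all add: right_mult_double_eigenvalue_def trace_right_mult_2 det_right_mult_2 algebra_defs
        algebra_simps)
  show "\<not> right_mult_double_eigenvalue A\<^sub>2" "\<not> right_mult_double_eigenvalue A\<^sub>3"
    by (auto dest!: D[of _ e\<^sub>1] simp: trace_right_mult_2 det_right_mult_2 algebra_defs)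
  show "\<alpha> \<noteq> 0 \<Longrightarrow> \<not> right_mult_double_eigenvalue (B\<^sub>1 \<alpha>)" "\<not> right_mult_double_eigenvalue B\<^sub>3"
    "\<not> right_mult_double_eigenvalue B\<^sub>4"
    by (auto dest!: D[of _ e\<^sub>2] simp: trace_right_mult_2 det_right_mult_2 algebra_defs)
qed

lemma left_mult_scalar_table:
  "left_mult_scalar A\<^sub>1" "left_mult_scalar (B\<^sub>1 (-1))" "\<not> left_mult_scalar A\<^sub>5"
  "\<not> left_mult_scalar (B\<^sub>2 (- (1 / 2)))" "\<not> left_mult_scalar B\<^sub>3"
proof -
  have S: "left_mult_scalar c \<Longrightarrow> 2 *s (c $ i $ j) = trace (left_mult c (axis i 1)) *s axis j 1"
    for c :: "(complex, 2) structure_constants" and i j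
    unfolding left_mult_scalar_def by (metis alg_mult_axis)
  show "left_mult_scalar A\<^sub>1" "left_mult_scalar (B\<^sub>1 (-1))"
    by (simp_all add: left_mult_scalar_def trace_left_mult_2 alg_mult_2 algebra_defs vec_eq_iff forall_2)
  show "\<not> left_mult_scalar A\<^sub>5" "\<not> left_mult_scalar B\<^sub>3"
    by (auto dest!: S[of _ 2 2] simp: trace_left_mult_2 algebra_defs vec_eq_iff forall_2)
  show "\<not> left_mult_scalar (B\<^sub>2 (- (1 / 2)))"
    by (auto dest!: S[of _ 1 2] simp: trace_left_mult_2 algebra_defs vec_eq_iff forall_2)
qed

lemma right_mult_scalar_table:
  "right_mult_scalar A\<^sub>1" "right_mult_scalar (B\<^sub>2 1)" "\<not> right_mult_scalar A\<^sub>5"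
  "\<not> right_mult_scalar (B\<^sub>1 2)" "\<not> right_mult_scalar B\<^sub>5"
proof -
  have S: "right_mult_scalar c \<Longrightarrow> 2 *s (c $ i $ j) = trace (right_mult c (axis j 1)) *s axis i 1"
    for c :: "(complex, 2) structure_constants" and i j
    unfolding right_mult_scalar_def by (metis alg_mult_axis)
  show "right_mult_scalar A\<^sub>1" "right_mult_scalar (B\<^sub>2 1)"
    by (simp_all add: right_mult_scalar_def trace_right_mult_2 alg_mult_2 algebra_defs vec_eq_iff forall_2)
  show "\<not> right_mult_scalar A\<^sub>5" "\<not> right_mult_scalar B\<^sub>5"
    by (auto dest!: S[of _ 2 2] simp: trace_right_mult_2 algebra_defs vec_eq_iff forall_2)
  show "\<not> right_mult_scalar (B\<^sub>1 2)"
    by (auto dest!: S[of _ 2 1] simp: trace_right_mult_2 algebra_defs vec_eq_iff forall_2)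
qed

lemma left_mult_singular_table:
  "left_mult_singular A\<^sub>1" "left_mult_singular A\<^sub>2" "left_mult_singular A\<^sub>5"
  "\<not> left_mult_singular A\<^sub>3" "\<not> left_mult_singular A\<^sub>4"
proof -
  have S: "left_mult_singular c \<Longrightarrow> det (left_mult c (e\<^sub>1 + e\<^sub>2)) = 0"
    for c :: "(complex, 2) structure_constants"
    unfolding left_mult_singular_def by blast
  show "left_mult_singular A\<^sub>1" "left_mult_singular A\<^sub>2" "left_mult_singular A\<^sub>5"
    by (simp_all add: left_mult_singular_def det_left_mult_2 algebra_defs)
  show "\<not> left_mult_singular A\<^sub>3" "\<not> left_mult_singular A\<^sub>4"
    by (auto dest!: S simp: det_left_mult_2 algebra_defs)
qed

section \<open>Classification of the two-dimensional pre-Lie algebras\<close>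

text \<open>
  The commutator is alternating, so it is the determinant times a fixed vector \<open>b\<close>. Then \<open>b\<close> together
  with any \<open>h\<close> of determinant \<open>1\<close> against \<open>b\<close> satisfies \<open>[b, h] = b\<close>.
\<close>
lemma commutator_table:
  assumes c: "\<not> commutative (c :: (complex, 2) structure_constants)"
  obtains u w z where "alg2 u (w + e\<^sub>1) w z \<in> GL_orbit c"
proof -
  define b where "b = c $ 1 $ 2 - c $ 2 $ 1"
  have "b \<noteq> 0" using c by (simp add: commutative_2 b_def)
  then have "b $ 1 \<noteq> 0 \<or> b $ 2 \<noteq> 0" by (simp add: vec_eq_iff forall_2)
  then obtain h :: "complex ^ 2" where h: "b $ 1 * h $ 2 - b $ 2 * h $ 1 = 1"
  proof
    assume "b $ 1 \<noteq> 0"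
    then show thesis by (intro that[of "vector [0, 1 / b $ 1]"]) simp
  next
    assume "b $ 2 \<noteq> 0"
    then show thesis by (intro that[of "vector [- 1 / b $ 2, 0]"]) simp
  qed
  then have indep: "b $ 1 * h $ 2 \<noteq> b $ 2 * h $ 1" by auto
  have "alg_mult c b h - alg_mult c h b = (b $ 1 * h $ 2 - b $ 2 * h $ 1) *s b"
    by (simp add: alg_mult_2 vec_eq_iff b_def algebra_simps)
  then have "alg_mult c b h - alg_mult c h b = b" by (simp only: h vector_smult_lid)
  then have bh: "alg_mult c b h = alg_mult c h b + b" by (simp add: algebra_simps)
  obtain u :: "complex ^ 2" where u: "alg_mult c b b = u $ 1 *s b + u $ 2 *s h"
    using basis_coordinates[OF indep] by blast
  obtain w :: "complex ^ 2" where w: "alg_mult c h b = w $ 1 *s b + w $ 2 *s h"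
    using basis_coordinates[OF indep] by blast
  obtain z :: "complex ^ 2" where z: "alg_mult c h h = z $ 1 *s b + z $ 2 *s h"
    using basis_coordinates[OF indep] by blast
  have "alg2 u (w + e\<^sub>1) w z \<in> GL_orbit c"
    by (rule table_in_basis_mem_GL_orbit[OF indep u _ w z])
      (simp add: bh w vec_eq_iff algebra_simps)
  then show ?thesis by (rule that)
qed

text \<open>
  These are the entries of the matrix identity \<open>L e\<^sub>1 = [L e\<^sub>1, L e\<^sub>2]\<close>, to which the pre-Lie identity
  for \<open>e\<^sub>1, e\<^sub>2\<close> reduces when \<open>[e\<^sub>1, e\<^sub>2] = e\<^sub>1\<close>. The last equation is the vanishing of the trace.
\<close>
lemma pre_Lie_commutator_table:
  assumes "alg2 u (w + e\<^sub>1) w z \<in> pre_Lie_variety"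
  shows "z $ 1 * u $ 2 = w $ 2 * (w $ 1 + 1) - u $ 1"
    and "u $ 1 * z $ 1 + (w $ 1 + 1) * z $ 2 = (w $ 1 + 1) * (w $ 1 + 1) + z $ 1 * w $ 2"
    and "u $ 2 * w $ 1 + w $ 2 * w $ 2 = w $ 2 * u $ 1 + z $ 2 * u $ 2 + u $ 2"
    and "u $ 1 = - w $ 2"
proof -
  let ?d = "alg2 u (w + e\<^sub>1) w z"
  have P: "alg_mult ?d (alg_mult ?d e\<^sub>1 e\<^sub>2) y - alg_mult ?d e\<^sub>1 (alg_mult ?d e\<^sub>2 y) =
     alg_mult ?d (alg_mult ?d e\<^sub>2 e\<^sub>1) y - alg_mult ?d e\<^sub>2 (alg_mult ?d e\<^sub>1 y)" for y
    using assms unfolding pre_Lie_variety_def by blast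
  note P1 = P[of e\<^sub>1, unfolded vec_eq_iff forall_2] and P2 = P[of e\<^sub>2, unfolded vec_eq_iff forall_2]
  show 1: "z $ 1 * u $ 2 = w $ 2 * (w $ 1 + 1) - u $ 1"
    using P1 by (simp add: alg_mult_2 algebra_simps)
  show "u $ 1 * z $ 1 + (w $ 1 + 1) * z $ 2 = (w $ 1 + 1) * (w $ 1 + 1) + z $ 1 * w $ 2"
    using P2 by (simp add: alg_mult_2 algebra_simps)
  show "u $ 2 * w $ 1 + w $ 2 * w $ 2 = w $ 2 * u $ 1 + z $ 2 * u $ 2 + u $ 2"
    using P1 by (simp add: alg_mult_2 algebra_simps)
  have "z $ 1 * u $ 2 = w $ 2 * (w $ 1 + 2)"
    using P2 by (simp add: alg_mult_2 algebra_simps)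
  then have "w $ 2 * (w $ 1 + 2) = w $ 2 * (w $ 1 + 1) - u $ 1" using 1 by simp
  then show "u $ 1 = - w $ 2" by algebra
qed

text \<open>
  In a basis with \<open>[e\<^sub>1, e\<^sub>2] = e\<^sub>1\<close> the matrix of \<open>L e\<^sub>1\<close> is nilpotent. The coefficient of \<open>e\<^sub>2\<close> in
  \<open>e\<^sub>1 \<cdot> e\<^sub>1\<close> decides whether \<open>e\<^sub>1\<close> lies in its kernel. If it vanishes, \<open>L e\<^sub>1\<close> is zero or has kernel
  \<open>e\<^sub>1\<close>, and a shift of \<open>e\<^sub>2\<close> along \<open>e\<^sub>1\<close> removes the coefficient \<open>r\<close> of \<open>e\<^sub>1\<close> in \<open>e\<^sub>2 \<cdot> e\<^sub>2\<close> unless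
  a resonance occurs; the resonant algebras with \<open>r \<noteq> 0\<close> are \<open>B\<^sub>3\<close> and \<open>B\<^sub>5\<close>. Otherwise \<open>e\<^sub>1\<close>
  and \<open>e\<^sub>1 \<cdot> e\<^sub>1\<close> form a basis, and the algebra is \<open>B\<^sub>4\<close>.
\<close>
lemma noncommutative_classification:
  assumes pL: "c \<in> pre_Lie_variety" and nc: "\<not> commutative (c :: (complex, 2) structure_constants)"
  shows "(\<exists>\<alpha>. B\<^sub>1 \<alpha> \<in> GL_orbit c) \<or> (\<exists>\<beta>. \<beta> \<noteq> 0 \<and> B\<^sub>2 \<beta> \<in> GL_orbit c) \<or>
    B\<^sub>3 \<in> GL_orbit c \<or> B\<^sub>4 \<in> GL_orbit c \<or> B\<^sub>5 \<in> GL_orbit c"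
proof -
  obtain u w z where d: "alg2 u (w + e\<^sub>1) w z \<in> GL_orbit c" using commutator_table[OF nc] .
  then have "alg2 u (w + e\<^sub>1) w z \<in> pre_Lie_variety"
    using GL_orbit_subset_pre_Lie_variety[OF pL] by blast
  note eqs = pre_Lie_commutator_table[OF this]
  define p where "p = w $ 1 + 1"
  define r s where "r = z $ 1" and "s = z $ 2"
  have w1: "w $ 1 = p - 1" by (simp add: p_def)
  have orbit: "X \<in> GL_orbit c" if "X \<in> GL_orbit (alg2 u (w + e\<^sub>1) w z)" for X
    using GL_orbit_trans[OF d that] .
  show ?thesis
  proof (cases "u $ 2 = 0")
    case True
    have w2: "w $ 2 = 0" and u1: "u $ 1 = 0" and ps: "p * s = p * p"
      using eqs True by (auto simp: w1 r_def s_def)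
    have d_eq: "alg2 u (w + e\<^sub>1) w z =
        alg2 0 (vector [p, 0]) (vector [p - 1, 0]) (vector [r, s])" (is "?d = ?d'")
      by (simp add: vec_eq_iff forall_2 True w1 w2 u1 r_def s_def)
    \<comment> \<open>Here \<open>p\<close> is the eigenvalue of right multiplication by \<open>e\<^sub>2\<close> at \<open>e\<^sub>1\<close>. The resonances
      are \<open>p = 0, s = -1\<close> and \<open>p = s = 1\<close>.\<close>
    consider "p = 0" "s \<noteq> -1" | "p = 0" "s = -1" "r = 0" | "p = 0" "s = -1" "r \<noteq> 0"
      | "p \<noteq> 0" "p \<noteq> 1" | "p = 1" "r = 0" | "p = 1" "r \<noteq> 0" by fastforce
    then show ?thesis
    proof cases
      case 1
      have "1 + s \<noteq> 0" using 1(2) by (simp add: add_eq_0_iff)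
      then obtain \<sigma> where r: "r = \<sigma> * (1 + s)" by (metis nonzero_eq_divide_eq)
      have "B\<^sub>1 s \<in> GL_orbit ?d'"
        unfolding B\<^sub>1_def using 1
        by (intro table_in_basis_mem_GL_orbit[of e\<^sub>1 "vector [\<sigma>, 1]"])
          (simp_all add: alg_mult_2 vec_eq_iff forall_2 r algebra_simps)
      then show ?thesis using orbit d_eq by metis
    next
      case 2
      have "B\<^sub>1 (-1) = ?d'"
        using 2 by (simp add: B\<^sub>1_def vec_eq_iff forall_2)
      then show ?thesis using orbit d_eq GL_orbit_refl by metis
    next
      case 3
      have "B\<^sub>3 \<in> GL_orbit ?d'"
        unfolding B\<^sub>3_def using 3
        by (intro table_in_basis_mem_GL_orbit[of "vector [r, 0]" e\<^sub>2])
          (simp_all add: alg_mult_2 vec_eq_iff forall_2)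
      then show ?thesis using orbit d_eq by metis
    next
      case 4
      have s: "s = p" using ps 4 by simp
      have "1 - p \<noteq> 0" using 4(2) by simp
      then obtain \<sigma> where r: "r = \<sigma> * (1 - p)" by (metis nonzero_eq_divide_eq)
      have "B\<^sub>2 p \<in> GL_orbit ?d'"
        unfolding B\<^sub>2_def
        by (intro table_in_basis_mem_GL_orbit[of e\<^sub>1 "vector [\<sigma>, 1]"])
          (simp_all add: alg_mult_2 vec_eq_iff forall_2 r s algebra_simps)
      then show ?thesis using orbit d_eq 4(1) by metis
    next
      case 5
      have "B\<^sub>2 1 = ?d'"
        using 5 ps by (simp add: B\<^sub>2_def vec_eq_iff forall_2)
      then show ?thesis using orbit d_eq GL_orbit_refl by (metis zero_neq_one)
    next
      case 6
      have "B\<^sub>5 \<in> GL_orbit ?d'"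
        unfolding B\<^sub>5_def using 6 ps
        by (intro table_in_basis_mem_GL_orbit[of "vector [r, 0]" e\<^sub>2])
          (simp_all add: alg_mult_2 vec_eq_iff forall_2)
      then show ?thesis using orbit d_eq by metis
    qed
  next
    case False
    \<comment> \<open>The basis is \<open>t e\<^sub>1\<close> and its square; the commutator normalisation forces \<open>t\<^sup>2 u\<^sub>2 = 1\<close>.\<close>
    define t where "t = 1 / csqrt (u $ 2)"
    have t: "t \<noteq> 0" and tu: "t * t * u $ 2 = 1"
      using False by (simp_all add: t_def power_divide flip: power2_eq_square)
    define q where "q = w $ 2"
    have u1: "u $ 1 = - q" using eqs(4) by (simp add: q_def)
    have ut: "u $ 2 = 1 / (t * t)" using t tu by (simp add: field_simps)
    have r: "r = q * (p + 1) * (t * t)"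
      using eqs(1) t unfolding u1 w1 ut by (simp add: field_simps flip: q_def r_def)
    have s: "s = p - 2 + 2 * q * q * (t * t)"
      using eqs(3) t unfolding u1 w1 ut by (simp add: field_simps flip: q_def s_def)
    have "- (q * r) + p * s = p * p + r * q"
      using eqs(2) unfolding u1 w1 by (simp flip: q_def s_def r_def)
    then have "2 * p = 2 * (- q * q * (t * t))"
      unfolding r s by algebra
    then have p: "p = - q * q * (t * t)" by simp
    have "B\<^sub>4 \<in> GL_orbit (alg2 u (w + e\<^sub>1) w z)"
      unfolding B\<^sub>4_def
      by (rule table_in_basis_mem_GL_orbit[of "vector [t, 0]" "vector [- q * (t * t), 1]"])
       (simp_all add: alg_mult_2 vec_eq_iff forall_2 t u1 ut w1 r s p algebra_simps
          flip: q_def r_def s_def)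
    then show ?thesis using orbit by blast
  qed
qed

text \<open>
  If \<open>x\<close> and \<open>x\<^sup>2\<close> are independent for some \<open>x\<close>, then \<open>x\<^sup>3 = p x\<^sup>2 + q x\<close> and the algebra consists of
  the polynomials in \<open>x\<close> without constant term. For \<open>p = q = 0\<close> it is nilpotent, for \<open>q = 0 \<noteq> p\<close> it splits
  into an idempotent and a null vector, and for \<open>q \<noteq> 0\<close> it is unital, namely the quotient of the
  polynomial ring by \<open>x\<^sup>2 - p x - q\<close>; distinct roots give \<open>A\<^sub>3\<close> and a double root gives \<open>A\<^sub>4\<close>.
  If \<open>x\<close> and \<open>x\<^sup>2\<close> are always dependent, then \<open>x \<cdot> x\<close> is a linear form times \<open>x\<close>, and associativity
  forces the form to vanish.
\<close>
lemma commutative_classification: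
  assumes pL: "c \<in> pre_Lie_variety" and cm: "commutative (c :: (complex, 2) structure_constants)"
  shows "A\<^sub>1 \<in> GL_orbit c \<or> A\<^sub>2 \<in> GL_orbit c \<or> A\<^sub>3 \<in> GL_orbit c \<or> A\<^sub>4 \<in> GL_orbit c \<or> A\<^sub>5 \<in> GL_orbit c"
proof (cases "\<exists>x. alg_mult c x x $ 1 * x $ 2 \<noteq> alg_mult c x x $ 2 * x $ 1")
  case True
  then obtain x where indep: "alg_mult c x x $ 1 * x $ 2 \<noteq> alg_mult c x x $ 2 * x $ 1" by blast
  let ?y = "alg_mult c x x"
  obtain w :: "complex ^ 2" where w: "alg_mult c x ?y = w $ 1 *s ?y + w $ 2 *s x"
    using basis_coordinates[OF indep] by blast
  obtain u :: "complex ^ 2" where u: "alg_mult c ?y ?y = u $ 1 *s ?y + u $ 2 *s x"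
    using basis_coordinates[OF indep] by blast
  define p q where "p = w $ 1" and "q = w $ 2"
  have yx: "alg_mult c ?y x = alg_mult c x ?y"
    using cm unfolding commutative_def by blast
  have d: "alg2 u w w e\<^sub>1 \<in> GL_orbit c"
    using indep by (rule table_in_basis_mem_GL_orbit) (simp_all add: u w yx)
  then have "alg2 u w w e\<^sub>1 \<in> pre_Lie_variety"
    using GL_orbit_subset_pre_Lie_variety[OF pL] by blast
  then have "alg_mult (alg2 u w w e\<^sub>1) (alg_mult (alg2 u w w e\<^sub>1) e\<^sub>1 e\<^sub>2) e\<^sub>2 -
      alg_mult (alg2 u w w e\<^sub>1) e\<^sub>1 (alg_mult (alg2 u w w e\<^sub>1) e\<^sub>2 e\<^sub>2) =
      alg_mult (alg2 u w w e\<^sub>1) (alg_mult (alg2 u w w e\<^sub>1) e\<^sub>2 e\<^sub>1) e\<^sub>2 -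
      alg_mult (alg2 u w w e\<^sub>1) e\<^sub>2 (alg_mult (alg2 u w w e\<^sub>1) e\<^sub>1 e\<^sub>2)"
    unfolding pre_Lie_variety_def by blast
  then have u12: "u $ 1 = p * p + q" "u $ 2 = p * q"
    by (simp_all add: alg_mult_2 vec_eq_iff forall_2 p_def q_def)
  have orbit: "X \<in> GL_orbit c" if "X \<in> GL_orbit (alg2 u w w e\<^sub>1)" for X
    using GL_orbit_trans[OF d that] .
  note table_simps = alg_mult_2 vec_eq_iff forall_2 u12 p_def[symmetric] q_def[symmetric]
  show ?thesis
  proof (cases "q = 0")
    case q: True
    show ?thesis
    proof (cases "p = 0")
      case True
      have "A\<^sub>5 = alg2 u w w e\<^sub>1" using q True by (simp add: A\<^sub>5_def table_simps)
      then show ?thesis using d by simp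
    next
      case False
      have "A\<^sub>2 \<in> GL_orbit (alg2 u w w e\<^sub>1)"
        unfolding A\<^sub>2_def using q False
        by (intro table_in_basis_mem_GL_orbit[of "vector [1 / (p * p), 0]" "vector [- 1 / p, 1]"])
          (simp_all add: table_simps field_simps)
      then show ?thesis using orbit by blast
    qed
  next
    case q: False
    define \<delta> where "\<delta> = csqrt (p * p + 4 * q)"
    \<comment> \<open>The roots of \<open>x\<^sup>2 - p x - q\<close>. For \<open>k \<noteq> l\<close> the basis vectors below are the two primitive
      idempotents; for \<open>k = l\<close> they are a nilpotent element and the unit.\<close>
    define k l where "k = (p + \<delta>) / 2" and "l = (p - \<delta>) / 2"
    have p: "p = k + l" by (simp add: k_def l_def field_simps)
    have "\<delta> * \<delta> = p * p + 4 * q" by (simp add: \<delta>_def flip: power2_eq_square)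
    then have qkl: "q = - k * l" by (simp add: k_def l_def field_simps)
    have k0: "k \<noteq> 0" and l0: "l \<noteq> 0" using q qkl by auto
    show ?thesis
    proof (cases "k = l")
      case True
      have "A\<^sub>4 \<in> GL_orbit (alg2 u w w e\<^sub>1)"
        unfolding A\<^sub>4_def using l0
        by (intro table_in_basis_mem_GL_orbit[of "vector [1, - l]" "vector [- 1 / (l * l), 2 / l]"])
          (simp_all add: table_simps p qkl True field_simps)
      then show ?thesis using orbit by blast
    next
      case False
      have kl: "k - l \<noteq> 0" using False by simp
      have "A\<^sub>3 \<in> GL_orbit (alg2 u w w e\<^sub>1)"
        unfolding A\<^sub>3_def using k0 l0 kl
        by (intro table_in_basis_mem_GL_orbit[of "vector [1 / (k * (k - l)), - l / (k * (k - l))]"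
              "vector [- 1 / (l * (k - l)), k / (l * (k - l))]"])
          (simp_all add: table_simps p qkl divide_simps, simp_all add: algebra_simps)
      then show ?thesis using orbit by blast
    qed
  qed
next
  case False
  then have P: "alg_mult c x x $ 1 * x $ 2 = alg_mult c x x $ 2 * x $ 1" for x by blast
  define p q where "p = c $ 1 $ 2 $ 1" and "q = c $ 1 $ 2 $ 2"
  have c21: "c $ 2 $ 1 = c $ 1 $ 2" using cm by (simp add: commutative_2)
  have c112: "c $ 1 $ 1 $ 2 = 0" and c221: "c $ 2 $ 2 $ 1 = 0"
    using P[of e\<^sub>1] P[of e\<^sub>2] by (simp_all add: alg_mult_axis)
  have c111: "c $ 1 $ 1 $ 1 = 2 * q" and c222: "c $ 2 $ 2 $ 2 = 2 * p"
  proof -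
    have 1: "c $ 1 $ 1 $ 1 + 2 * p = c $ 2 $ 2 $ 2 + 2 * q"
      using P[of "e\<^sub>1 + e\<^sub>2"] by (simp add: alg_mult_2 c21 c112 c221 p_def q_def algebra_simps)
    have 2: "c $ 1 $ 1 $ 1 - 2 * p = - (c $ 2 $ 2 $ 2) + 2 * q"
      using P[of "e\<^sub>1 - e\<^sub>2"] by (simp add: alg_mult_2 c21 c112 c221 p_def q_def algebra_simps)
    have "2 * c $ 1 $ 1 $ 1 = 2 * (2 * q)" "2 * c $ 2 $ 2 $ 2 = 2 * (2 * p)"
      using 1 2 by algebra+
    then show "c $ 1 $ 1 $ 1 = 2 * q" "c $ 2 $ 2 $ 2 = 2 * p" by simp_all
  qed
  have "alg_mult c (alg_mult c e\<^sub>1 e\<^sub>2) y - alg_mult c e\<^sub>1 (alg_mult c e\<^sub>2 y) =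
     alg_mult c (alg_mult c e\<^sub>2 e\<^sub>1) y - alg_mult c e\<^sub>2 (alg_mult c e\<^sub>1 y)" for y
    using pL unfolding pre_Lie_variety_def by blast
  from this[of e\<^sub>1] this[of e\<^sub>2] have "p = 0" "q = 0"
    by (simp_all add: alg_mult_2 vec_eq_iff forall_2 c21 c112 c221 c111 c222 flip: p_def q_def)
  then have "c = A\<^sub>1"
    by (simp add: A\<^sub>1_def vec_eq_iff forall_2 c21 c112 c221 c111 c222 flip: p_def q_def)
  then show ?thesis using GL_orbit_refl by blast
qed

section \<open>The degenerations\<close>

text \<open>
  The algebras listed are the ones in the classification that satisfy the trace relation with the
  parameter \<open>k\<close>. For \<open>k = 0\<close> the algebra \<open>B\<^sub>2 (k / 2)\<close> would coincide with \<open>B\<^sub>1 k\<close>.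
\<close>
lemma trace_relation_closure_cases:
  assumes pL: "c \<in> pre_Lie_variety" and tr: "trace_relation k c"
    and d: "d \<in> Zariski_closure (GL_orbit c)"
  shows "d \<in> GL_orbit A\<^sub>1 \<or> d \<in> GL_orbit A\<^sub>5 \<or> d \<in> GL_orbit (B\<^sub>1 k) \<or>
    k \<noteq> 0 \<and> d \<in> GL_orbit (B\<^sub>2 (k / 2)) \<or> k = -1 \<and> d \<in> GL_orbit B\<^sub>3 \<or>
    k = -2 \<and> d \<in> GL_orbit B\<^sub>4 \<or> k = 2 \<and> d \<in> GL_orbit B\<^sub>5"
proof -
  have "trace_relation k d"
    by (rule closed_invariant_Zariski_closure[OF closed_invariant_trace_relation tr d])
  then have X: "trace_relation k X \<and> d \<in> GL_orbit X" if "X \<in> GL_orbit d" for X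
    using closed_invariant_GL_orbit[OF closed_invariant_trace_relation that] GL_orbit_sym[OF that]
    by simp
  have dpL: "d \<in> pre_Lie_variety" using Zariski_closure_GL_orbit_subset[OF pL] d by blast
  show ?thesis
  proof (cases "commutative d")
    case True
    then show ?thesis
      using commutative_classification[OF dpL] by (auto dest!: X simp: trace_relation_table)
  next
    case False
    then show ?thesis
      using noncommutative_classification[OF dpL] by (auto dest!: X simp: trace_relation_table)
  qed
qed

lemma commutative_closure_cases:
  assumes pL: "c \<in> pre_Lie_variety" and cm: "commutative c"
    and d: "d \<in> Zariski_closure (GL_orbit c)"
  shows "d \<in> GL_orbit A\<^sub>1 \<or> d \<in> GL_orbit A\<^sub>2 \<or> d \<in> GL_orbit A\<^sub>3 \<or> d \<in> GL_orbit A\<^sub>4 \<or>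
    d \<in> GL_orbit A\<^sub>5"
proof -
  have "commutative d"
    by (rule closed_invariant_Zariski_closure[OF closed_invariant_commutative cm d])
  moreover have "d \<in> pre_Lie_variety" using Zariski_closure_GL_orbit_subset[OF pL] d by blast
  ultimately show ?thesis using commutative_classification GL_orbit_sym by metis
qed

lemma proper_degenerations_eqI:
  fixes c :: "(complex, 'n::finite) structure_constants"
  assumes cases: "\<And>d. d \<in> Zariski_closure (GL_orbit c) \<Longrightarrow> d \<in> GL_orbit c \<union> \<Union> (GL_orbit ` S)"
    and degen: "\<And>s. s \<in> S \<Longrightarrow> s \<in> closure (GL_orbit c)"
    and proper: "\<And>s. s \<in> S \<Longrightarrow> s \<notin> GL_orbit c"
  shows "Zariski_closure (GL_orbit c) - GL_orbit c = \<Union> (GL_orbit ` S)"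
proof
  show "Zariski_closure (GL_orbit c) - GL_orbit c \<subseteq> \<Union> (GL_orbit ` S)" using cases by blast
  show "\<Union> (GL_orbit ` S) \<subseteq> Zariski_closure (GL_orbit c) - GL_orbit c"
  proof
    fix d assume "d \<in> \<Union> (GL_orbit ` S)"
    then obtain s where s: "s \<in> S" "d \<in> GL_orbit s" by blast
    have "d \<in> closure (GL_orbit c)" using GL_orbit_subset_closure[OF degen[OF s(1)]] s(2) by blast
    moreover have "d \<notin> GL_orbit c" using GL_orbit_trans GL_orbit_sym[OF s(2)] proper[OF s(1)] by blast
    ultimately show "d \<in> Zariski_closure (GL_orbit c) - GL_orbit c"
      using closure_subset_Zariski_closure by blast
  qed
qed

lemma A\<^sub>5_mem_closure_table:
  "A\<^sub>5 \<in> closure (GL_orbit A\<^sub>2)" "A\<^sub>5 \<in> closure (GL_orbit A\<^sub>3)" "A\<^sub>5 \<in> closure (GL_orbit A\<^sub>4)"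
  "\<alpha> \<noteq> -1 \<Longrightarrow> A\<^sub>5 \<in> closure (GL_orbit (B\<^sub>1 \<alpha>))" "\<beta> \<noteq> 1 \<Longrightarrow> A\<^sub>5 \<in> closure (GL_orbit (B\<^sub>2 \<beta>))"
  "A\<^sub>5 \<in> closure (GL_orbit B\<^sub>3)" "A\<^sub>5 \<in> closure (GL_orbit B\<^sub>4)" "A\<^sub>5 \<in> closure (GL_orbit B\<^sub>5)"
proof -
  show "A\<^sub>5 \<in> closure (GL_orbit A\<^sub>2)" "A\<^sub>5 \<in> closure (GL_orbit A\<^sub>4)"
    "\<beta> \<noteq> 1 \<Longrightarrow> A\<^sub>5 \<in> closure (GL_orbit (B\<^sub>2 \<beta>))"
    by (rule A\<^sub>5_mem_closure[of "e\<^sub>1 + e\<^sub>2"]; simp add: alg_mult_2 algebra_defs)+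
  show "\<alpha> \<noteq> -1 \<Longrightarrow> A\<^sub>5 \<in> closure (GL_orbit (B\<^sub>1 \<alpha>))"
    by (rule A\<^sub>5_mem_closure[of "e\<^sub>1 + e\<^sub>2"]) (simp add: alg_mult_2 algebra_defs)
  show "A\<^sub>5 \<in> closure (GL_orbit A\<^sub>3)"
    using closure_GL_orbit_trans[OF A\<^sub>2_mem_closure_A\<^sub>3] \<open>A\<^sub>5 \<in> closure (GL_orbit A\<^sub>2)\<close> .
  show "A\<^sub>5 \<in> closure (GL_orbit B\<^sub>3)" "A\<^sub>5 \<in> closure (GL_orbit B\<^sub>5)"
    by (rule A\<^sub>5_mem_closure[of e\<^sub>2]; simp add: alg_mult_2 algebra_defs)+
  show "A\<^sub>5 \<in> closure (GL_orbit B\<^sub>4)"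
    by (rule A\<^sub>5_mem_closure[of e\<^sub>1]) (simp add: alg_mult_2 algebra_defs)
qed

lemmas condition_table = commutative_table trace_relation_table left_mult_proportional_table
  right_mult_double_eigenvalue_table left_mult_scalar_table right_mult_scalar_table
  left_mult_singular_table

lemmas closed_invariants = closed_invariant_commutative closed_invariant_left_mult_proportional
  closed_invariant_right_mult_double_eigenvalue closed_invariant_left_mult_scalar
  closed_invariant_right_mult_scalar closed_invariant_left_mult_singular

lemmas orbit_dests = closed_invariants[THEN closed_invariant_GL_orbit]

lemma closed_invariant_excludes:
  assumes "closed_invariant P" "P c" "d \<in> Zariski_closure (GL_orbit c)" "\<not> P X"
  shows "d \<notin> GL_orbit X"
  using closed_invariant_Zariski_closure[OF assms(1-3)] closed_invariant_GL_orbit[OF assms(1)] assms(4)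
  by blast

lemmas proper_degenerations_simps = condition_table pre_Lie_algebras A\<^sub>1_mem_closure
  A\<^sub>5_mem_closure_table A\<^sub>2_mem_closure_A\<^sub>3 A\<^sub>4_mem_closure_A\<^sub>3 B\<^sub>1_mem_closure_B\<^sub>4
  B\<^sub>2_mem_closure_B\<^sub>4 B\<^sub>1_mem_closure_B\<^sub>3 B\<^sub>2_mem_closure_B\<^sub>5

theorem theorem4p3:
  "(Zariski_closure (GL_orbit A\<^sub>3) - GL_orbit A\<^sub>3 = \<Union> (GL_orbit ` {A\<^sub>2, A\<^sub>4, A\<^sub>5, A\<^sub>1})) \<and>
   (Zariski_closure (GL_orbit B\<^sub>4) - GL_orbit B\<^sub>4 = \<Union> (GL_orbit ` {B\<^sub>1 (-2), B\<^sub>2 (-1), A\<^sub>5, A\<^sub>1})) \<and>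
   (Zariski_closure (GL_orbit A\<^sub>2) - GL_orbit A\<^sub>2 = \<Union> (GL_orbit ` {A\<^sub>5, A\<^sub>1})) \<and>
   (Zariski_closure (GL_orbit A\<^sub>4) - GL_orbit A\<^sub>4 = \<Union> (GL_orbit ` {A\<^sub>5, A\<^sub>1})) \<and>
   (\<forall>\<alpha>::complex. \<alpha> \<noteq> -1 \<longrightarrow>
     Zariski_closure (GL_orbit (B\<^sub>1 \<alpha>)) - GL_orbit (B\<^sub>1 \<alpha>) = \<Union> (GL_orbit ` {A\<^sub>5, A\<^sub>1})) \<and>
   (\<forall>\<beta>::complex. \<beta> \<noteq> 0 \<and> \<beta> \<noteq> 1 \<longrightarrow>
     Zariski_closure (GL_orbit (B\<^sub>2 \<beta>)) - GL_orbit (B\<^sub>2 \<beta>) = \<Union> (GL_orbit ` {A\<^sub>5, A\<^sub>1})) \<and>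
   (Zariski_closure (GL_orbit B\<^sub>3) - GL_orbit B\<^sub>3 = \<Union> (GL_orbit ` {A\<^sub>5, B\<^sub>1 (-1), A\<^sub>1})) \<and>
   (Zariski_closure (GL_orbit B\<^sub>5) - GL_orbit B\<^sub>5 = \<Union> (GL_orbit ` {A\<^sub>5, B\<^sub>2 1, A\<^sub>1})) \<and>
   (Zariski_closure (GL_orbit A\<^sub>5) - GL_orbit A\<^sub>5 = GL_orbit A\<^sub>1) \<and>
   (Zariski_closure (GL_orbit (B\<^sub>1 (-1))) - GL_orbit (B\<^sub>1 (-1)) = GL_orbit A\<^sub>1) \<and>
   (Zariski_closure (GL_orbit (B\<^sub>2 1)) - GL_orbit (B\<^sub>2 1) = GL_orbit A\<^sub>1)"
proof (intro conjI allI impI)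
  note simps = proper_degenerations_simps
  note exc = closed_invariant_excludes
  show "Zariski_closure (GL_orbit A\<^sub>3) - GL_orbit A\<^sub>3 = \<Union> (GL_orbit ` {A\<^sub>2, A\<^sub>4, A\<^sub>5, A\<^sub>1})"
  proof (rule proper_degenerations_eqI)
    show "d \<in> GL_orbit A\<^sub>3 \<union> \<Union> (GL_orbit ` {A\<^sub>2, A\<^sub>4, A\<^sub>5, A\<^sub>1})"
      if "d \<in> Zariski_closure (GL_orbit A\<^sub>3)" for d
      using commutative_closure_cases[OF _ _ that] by (auto simp: simps)
  qed (auto simp: simps dest: orbit_dests)
  show "Zariski_closure (GL_orbit B\<^sub>4) - GL_orbit B\<^sub>4 =
      \<Union> (GL_orbit ` {B\<^sub>1 (-2), B\<^sub>2 (-1), A\<^sub>5, A\<^sub>1})"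
  proof (rule proper_degenerations_eqI)
    show "d \<in> GL_orbit B\<^sub>4 \<union> \<Union> (GL_orbit ` {B\<^sub>1 (-2), B\<^sub>2 (-1), A\<^sub>5, A\<^sub>1})"
      if "d \<in> Zariski_closure (GL_orbit B\<^sub>4)" for d
      using trace_relation_closure_cases[OF _ _ that, of "-2"] by (auto simp: simps)
  qed (auto simp: simps dest: orbit_dests)
  show "Zariski_closure (GL_orbit A\<^sub>2) - GL_orbit A\<^sub>2 = \<Union> (GL_orbit ` {A\<^sub>5, A\<^sub>1})"
  proof (rule proper_degenerations_eqI)
    show "d \<in> GL_orbit A\<^sub>2 \<union> \<Union> (GL_orbit ` {A\<^sub>5, A\<^sub>1})"
      if d: "d \<in> Zariski_closure (GL_orbit A\<^sub>2)" for d
      using commutative_closure_cases[OF _ _ d] exc[OF closed_invariant_left_mult_singular _ d]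
      by (auto simp: simps)
  qed (auto simp: simps dest: orbit_dests)
  show "Zariski_closure (GL_orbit A\<^sub>4) - GL_orbit A\<^sub>4 = \<Union> (GL_orbit ` {A\<^sub>5, A\<^sub>1})"
  proof (rule proper_degenerations_eqI)
    show "d \<in> GL_orbit A\<^sub>4 \<union> \<Union> (GL_orbit ` {A\<^sub>5, A\<^sub>1})"
      if d: "d \<in> Zariski_closure (GL_orbit A\<^sub>4)" for d
      using commutative_closure_cases[OF _ _ d]
        exc[OF closed_invariant_right_mult_double_eigenvalue _ d] by (auto simp: simps)
  qed (auto simp: simps dest: orbit_dests)
  show "Zariski_closure (GL_orbit (B\<^sub>1 \<alpha>)) - GL_orbit (B\<^sub>1 \<alpha>) = \<Union> (GL_orbit ` {A\<^sub>5, A\<^sub>1})"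
    if "\<alpha> \<noteq> -1" for \<alpha>
  proof (rule proper_degenerations_eqI)
    show "d \<in> GL_orbit (B\<^sub>1 \<alpha>) \<union> \<Union> (GL_orbit ` {A\<^sub>5, A\<^sub>1})"
      if d: "d \<in> Zariski_closure (GL_orbit (B\<^sub>1 \<alpha>))" for d
      using trace_relation_closure_cases[OF _ _ d, of \<alpha>] \<open>\<alpha> \<noteq> -1\<close>
        exc[OF closed_invariant_left_mult_proportional _ d] by (auto simp: simps)
  qed (use that in \<open>auto simp: simps dest: orbit_dests\<close>)
  show "Zariski_closure (GL_orbit (B\<^sub>2 \<beta>)) - GL_orbit (B\<^sub>2 \<beta>) = \<Union> (GL_orbit ` {A\<^sub>5, A\<^sub>1})"
    if "\<beta> \<noteq> 0 \<and> \<beta> \<noteq> 1" for \<beta>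
  proof (rule proper_degenerations_eqI)
    show "d \<in> GL_orbit (B\<^sub>2 \<beta>) \<union> \<Union> (GL_orbit ` {A\<^sub>5, A\<^sub>1})"
      if d: "d \<in> Zariski_closure (GL_orbit (B\<^sub>2 \<beta>))" for d
      using trace_relation_closure_cases[OF _ _ d, of "2 * \<beta>"] \<open>\<beta> \<noteq> 0 \<and> \<beta> \<noteq> 1\<close>
        exc[OF closed_invariant_right_mult_double_eigenvalue _ d] by (auto simp: simps)
  qed (use that in \<open>auto simp: simps dest: orbit_dests\<close>)
  show "Zariski_closure (GL_orbit B\<^sub>3) - GL_orbit B\<^sub>3 = \<Union> (GL_orbit ` {A\<^sub>5, B\<^sub>1 (-1), A\<^sub>1})"
  proof (rule proper_degenerations_eqI)
    show "d \<in> GL_orbit B\<^sub>3 \<union> \<Union> (GL_orbit ` {A\<^sub>5, B\<^sub>1 (-1), A\<^sub>1})"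
      if d: "d \<in> Zariski_closure (GL_orbit B\<^sub>3)" for d
      using trace_relation_closure_cases[OF _ _ d, of "-1"]
        exc[OF closed_invariant_left_mult_proportional _ d] by (auto simp: simps)
  qed (auto simp: simps dest: orbit_dests)
  show "Zariski_closure (GL_orbit B\<^sub>5) - GL_orbit B\<^sub>5 = \<Union> (GL_orbit ` {A\<^sub>5, B\<^sub>2 1, A\<^sub>1})"
  proof (rule proper_degenerations_eqI)
    show "d \<in> GL_orbit B\<^sub>5 \<union> \<Union> (GL_orbit ` {A\<^sub>5, B\<^sub>2 1, A\<^sub>1})"
      if d: "d \<in> Zariski_closure (GL_orbit B\<^sub>5)" for d
      using trace_relation_closure_cases[OF _ _ d, of 2]
        exc[OF closed_invariant_right_mult_double_eigenvalue _ d] by (auto simp: simps)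
  qed (auto simp: simps dest: orbit_dests)
  have "Zariski_closure (GL_orbit A\<^sub>5) - GL_orbit A\<^sub>5 = \<Union> (GL_orbit ` {A\<^sub>1})"
  proof (rule proper_degenerations_eqI)
    show "d \<in> GL_orbit A\<^sub>5 \<union> \<Union> (GL_orbit ` {A\<^sub>1})"
      if d: "d \<in> Zariski_closure (GL_orbit A\<^sub>5)" for d
      using trace_relation_closure_cases[OF _ _ d, of 0]
        exc[OF closed_invariant_commutative _ d] by (auto simp: simps)
  qed (auto simp: simps dest: orbit_dests)
  then show "Zariski_closure (GL_orbit A\<^sub>5) - GL_orbit A\<^sub>5 = GL_orbit A\<^sub>1" by simp
  have "Zariski_closure (GL_orbit (B\<^sub>1 (-1))) - GL_orbit (B\<^sub>1 (-1)) = \<Union> (GL_orbit ` {A\<^sub>1})"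
  proof (rule proper_degenerations_eqI)
    show "d \<in> GL_orbit (B\<^sub>1 (-1)) \<union> \<Union> (GL_orbit ` {A\<^sub>1})"
      if d: "d \<in> Zariski_closure (GL_orbit (B\<^sub>1 (-1)))" for d
      using trace_relation_closure_cases[OF _ _ d, of "-1"]
        exc[OF closed_invariant_left_mult_scalar _ d] by (auto simp: simps)
  qed (auto simp: simps dest: orbit_dests)
  then show "Zariski_closure (GL_orbit (B\<^sub>1 (-1))) - GL_orbit (B\<^sub>1 (-1)) = GL_orbit A\<^sub>1" by simp
  have "Zariski_closure (GL_orbit (B\<^sub>2 1)) - GL_orbit (B\<^sub>2 1) = \<Union> (GL_orbit ` {A\<^sub>1})"
  proof (rule proper_degenerations_eqI)
    show "d \<in> GL_orbit (B\<^sub>2 1) \<union> \<Union> (GL_orbit ` {A\<^sub>1})"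
      if d: "d \<in> Zariski_closure (GL_orbit (B\<^sub>2 1))" for d
      using trace_relation_closure_cases[OF _ _ d, of 2]
        exc[OF closed_invariant_right_mult_scalar _ d] by (auto simp: simps)
  qed (auto simp: simps dest: orbit_dests)
  then show "Zariski_closure (GL_orbit (B\<^sub>2 1)) - GL_orbit (B\<^sub>2 1) = GL_orbit A\<^sub>1" by simp
qed

end
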